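(* Let $A\to B$ be an extension of domains. The central seminormalization $A^{s_c,*}_B$ of $A$ in $B$ exists, and moreover: 1) If $A$ is a real domain, then $$A^{s_c,*}_B=A^{s_c}_{\widetilde{A}_B'}=\{b\in\widetilde{A}_B'\mid\forall\mathfrak p\in\text{C-Spec}\,A,\ b_{\mathfrak p}\in A_{\mathfrak p}+\mathrm{Rad}^C((\widetilde{A}_B')_{\mathfrak p})\},$$ where $\widetilde{A}_B'$ is the integral and birational closure of $A$ in $B$. 2) If $A$ is not a real domain, then $A^{s_c,*}_B=A_B'=A^{s_c}_{A_B'}$, where $A_B'$ is the integral closure of $A$ in $B$.
   Context: All rings are commutative and contain $\mathbb{Q}$; an extension is an injective ring homomorphism. For a domain $A$, $\mathcal{K}(A)$ is its fraction field and $\sum\mathcal{K}(A)^2$ the set of finite sums of squares in $\mathcal{K}(A)$. $A$ is a real domain if $-1\notin\sum\mathcal{K}(A)^2$. An ideal $I\subset A$ is central if for all $a\in A$, $b\in\sum\mathcal{K}(A)^2$, $a^2+b\in I$ implies $a\in I$. $\text{C-Spec}\,A$ is the set of central prime ideals of $A$. For an extension of domains $A\to B$, contraction gives a well-defined map $\text{C-Spec}\,B\to\text{C-Spec}\,A$. $A\to B$ is centrally subintegral ($s_c$-subintegral) if it is integral and the map $\text{C-Spec}\,B\to\text{C-Spec}\,A$ is bijective and equiresidual, i.e. for every $\mathfrak q\in\text{C-Spec}\,B$ the map of residue fields $k(\mathfrak q\cap A)\to k(\mathfrak q)$ is an isomorphism. The central seminormalization $A^{s_c,*}_B$ of $A$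 in $B$ is, when it exists, the unique maximal element among the intermediate domains $A\subset C\subset B$ such that $A\to C$ is $s_c$-subintegral. $\mathrm{Rad}^C(R)$ is the intersection of all ideals of the domain $R$ that are both maximal and central (it equals $R$ if there are none). For $\mathfrak p\in\mathrm{Spec}\,A$ and an extension $A\to B$, $B_{\mathfrak p}=(A\setminus\mathfrak p)^{-1}B$ and $b_{\mathfrak p}$ is the image of $b$ in $B_{\mathfrak p}$. For an integral extension of domains $A\to B$, the central gluing of $B$ over $A$ is $A^{s_c}_B=\{b\in B\mid\forall\mathfrak p\in\text{C-Spec}\,A,\ b_{\mathfrak p}\in A_{\mathfrak p}+\mathrm{Rad}^C(B_{\mathfrak p})\}$. The birational closure of $A$ in $B$ is $\widetilde{A}_B=B\times_{\mathcal{K}(B)}\mathcal{K}(A)=B\cap\mathcal{K}(A)$; the integral and birational closure $\widetilde{A}_B'$ is the integral closure of $A$ in $\widetilde{A}_B$, i.e. the set of elements of $B\cap\mathcal{K}(A)$ integral over $A$. *)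

theory Defs
  imports "HOL-Algebra.Algebraic_Closure_Type"
begin

text \<open>
  Domains are treated as subrings of a fixed ambient field of type \<open>'k\<close>. An extension
  \<open>f : A \<rightarrow> B\<close> of domains is replaced, in the main statement, by the inclusion of the images of
  \<open>A\<close> and \<open>B\<close> in the fraction field of \<open>B\<close>. Since all rings involved are domains, every
  fraction field and every localization then is a set of fractions inside that field, and the
  canonical maps between them are inclusions.
\<close>

abbreviation ring_on :: "'k::field set \<Rightarrow> 'k ring" where
  "ring_on R \<equiv> ring_of_type_algebra\<lparr>carrier := R\<rparr>"

definition contains_rationals :: "'a::comm_ring_1 itself \<Rightarrow> bool" where
  "contains_rationals T \<longleftrightarrow> (\<forall>n::nat. 0 < n \<longrightarrow> of_nat n dvd (1::'a))"

definition frac_field_of :: "'k::field set \<Rightarrow> 'k set" where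
  "frac_field_of R = {a / b | a b. a \<in> R \<and> b \<in> R \<and> b \<noteq> 0}"

definition sums_of_squares :: "'k::field set \<Rightarrow> 'k set" where
  "sums_of_squares F = {\<Sum>x\<leftarrow>xs. x ^ 2 | xs. set xs \<subseteq> F}"

definition real_domain :: "'k::field set \<Rightarrow> bool" where
  "real_domain R \<longleftrightarrow> - 1 \<notin> sums_of_squares (frac_field_of R)"

definition central :: "'k::field set \<Rightarrow> 'k set \<Rightarrow> bool" where
  "central R I \<longleftrightarrow> ideal I (ring_on R) \<and>
     (\<forall>a\<in>R. \<forall>b\<in>sums_of_squares (frac_field_of R). a ^ 2 + b \<in> I \<longrightarrow> a \<in> I)"

definition C_Spec :: "'k::field set \<Rightarrow> 'k set set" where
  "C_Spec R = {p. primeideal p (ring_on R) \<and> central R p}"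

definition Rad_C :: "'k::field set \<Rightarrow> 'k set" where
  "Rad_C R = R \<inter> \<Inter>{m. maximalideal m (ring_on R) \<and> central R m}"

text \<open>
  \<open>loc R p M\<close> is \<open>M\<close> localized at the multiplicative set \<open>R - p\<close>; it is used for the ring \<open>R\<close>
  itself, for extensions of \<open>R\<close> and for the prime \<open>p\<close>, where it yields the maximal ideal
  of the local ring \<open>loc R p R\<close>.
\<close>

definition loc :: "'k::field set \<Rightarrow> 'k set \<Rightarrow> 'k set \<Rightarrow> 'k set" where
  "loc R p M = {m / s | m s. m \<in> M \<and> s \<in> R - p}"

definition residue_field :: "'k::field set \<Rightarrow> 'k set \<Rightarrow> 'k set ring" where
  "residue_field R p = ring_on (loc R p R) Quot (loc R p p)"

text \<open>
  For a prime \<open>q\<close> of \<open>S \<supseteq> R\<close>, the map from the residue field of \<open>R\<close> at \<open>q \<inter> R\<close> to that of \<open>S\<close>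
  at \<open>q\<close>. It is induced by the inclusion of local rings: the coset of \<open>x\<close> goes to the coset of
  \<open>x\<close>, which is the sum of the former coset and the maximal ideal at \<open>q\<close>.
\<close>

definition residue_map :: "'k::field set \<Rightarrow> 'k set \<Rightarrow> 'k set \<Rightarrow> 'k set" where
  "residue_map S q Z = loc S q q <+>\<^bsub>ring_on (loc S q S)\<^esub> Z"

definition integral_over :: "'k::field set \<Rightarrow> 'k \<Rightarrow> bool" where
  "integral_over R x \<longleftrightarrow>
     (\<exists>P::'k poly. lead_coeff P = 1 \<and> (\<forall>i. Polynomial.coeff P i \<in> R) \<and> poly P x = 0)"

definition integral_closure_in :: "'k::field set \<Rightarrow> 'k set \<Rightarrow> 'k set" where
  "integral_closure_in R S = {x \<in> S. integral_over R x}"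

definition birational_closure_in :: "'k::field set \<Rightarrow> 'k set \<Rightarrow> 'k set" where
  "birational_closure_in R S = S \<inter> frac_field_of R"

definition integral_birational_closure_in :: "'k::field set \<Rightarrow> 'k set \<Rightarrow> 'k set" where
  "integral_birational_closure_in R S = integral_closure_in R (birational_closure_in R S)"

definition sc_subintegral :: "'k::field set \<Rightarrow> 'k set \<Rightarrow> bool" where
  "sc_subintegral R S \<longleftrightarrow>
     (\<forall>x\<in>S. integral_over R x) \<and>
     bij_betw (\<lambda>q. q \<inter> R) (C_Spec S) (C_Spec R) \<and>
     (\<forall>q\<in>C_Spec S. residue_map S q \<in> ring_iso (residue_field R (q \<inter> R)) (residue_field S q))"

definition sc_intermediate :: "'k::field set \<Rightarrow> 'k set \<Rightarrow> 'k set \<Rightarrow> bool" where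
  "sc_intermediate R S C \<longleftrightarrow>
     subdomain C ring_of_type_algebra \<and> R \<subseteq> C \<and> C \<subseteq> S \<and> sc_subintegral R C"

definition maximal_sc_intermediate :: "'k::field set \<Rightarrow> 'k set \<Rightarrow> 'k set \<Rightarrow> bool" where
  "maximal_sc_intermediate R S C \<longleftrightarrow>
     sc_intermediate R S C \<and> (\<forall>D. sc_intermediate R S D \<and> C \<subseteq> D \<longrightarrow> D = C)"

definition central_seminormalization_exists :: "'k::field set \<Rightarrow> 'k set \<Rightarrow> bool" where
  "central_seminormalization_exists R S \<longleftrightarrow> (\<exists>!C. maximal_sc_intermediate R S C)"

definition central_seminormalization :: "'k::field set \<Rightarrow> 'k set \<Rightarrow> 'k set" where
  "central_seminormalization R S = (THE C. maximal_sc_intermediate R S C)"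

definition central_gluing :: "'k::field set \<Rightarrow> 'k set \<Rightarrow> 'k set" where
  "central_gluing R S =
     {b \<in> S. \<forall>p\<in>C_Spec R. b \<in> {a + r | a r. a \<in> loc R p R \<and> r \<in> Rad_C (loc R p S)}}"

end

theory Submission
  imports Defs "Jordan_Normal_Form.Char_Poly"
begin

text \<open>
  If \<open>A\<close> is not real, then neither is any extension of \<open>A\<close>, there are no central primes at all, and
  being centrally subintegral just means being integral. Let \<open>A\<close> be real. Then the zero ideal is
  central, so a centrally subintegral extension of \<open>A\<close> is birational, hence lies in the integral and
  birational closure \<open>D\<close> of \<open>A\<close> in \<open>B\<close>. The gluing \<open>G\<close> of \<open>D\<close> over \<open>A\<close> is the largest such
  extension: the maximal central ideals of a localization \<open>D\<^sub>p\<close> are exactly the localizations of the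
  central primes over \<open>p\<close>, so membership in \<open>G\<close> says that modulo all central primes over \<open>p\<close>
  simultaneously an element agrees with one and the same fraction from \<open>A\<^sub>p\<close>.

  That \<open>G\<close> itself is centrally subintegral rests on lying over for central primes. Its core is an
  archimedean property: an element \<open>b\<close> of the fraction field that is integral over \<open>A\<close> has its
  square bounded, up to sums of squares, by an element of \<open>A\<close>. Consequently the elements of \<open>D\<close> whose
  square is bounded by an element of \<open>p\<close> form an ideal over \<open>p\<close>, with no recourse to orderings of
  the fraction field.
\<close>

hide_const (open) Ring_Hom.ring_hom

section \<open>Subrings of a field and their ideals\<close>

abbreviation subdom :: "'k::field set \<Rightarrow> bool" where
  "subdom R \<equiv> subdomain R ring_of_type_algebra"

lemma ring_of_type_algebra_simps [simp]:
  "carrier (ring_of_type_algebra :: 'k::field ring) = UNIV"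
  "monoid.mult (ring_of_type_algebra :: 'k::field ring) = (*)"
  "monoid.one (ring_of_type_algebra :: 'k::field ring) = 1"
  "ring.zero (ring_of_type_algebra :: 'k::field ring) = 0"
  "ring.add (ring_of_type_algebra :: 'k::field ring) = (+)"
  by (simp_all add: ring_of_type_algebra_def)

lemma a_inv_ring_of_type_algebra [simp]:
  "a_inv (ring_of_type_algebra :: 'k::field ring) x = - x"
proof -
  interpret field "ring_of_type_algebra :: 'k ring" by (rule field_from_type_algebra)
  show ?thesis by (rule minus_equality) auto
qed

lemma subdomI:
  assumes "1 \<in> R" "\<And>x y. x \<in> R \<Longrightarrow> y \<in> R \<Longrightarrow> x - y \<in> R" "\<And>x y. x \<in> R \<Longrightarrow> y \<in> R \<Longrightarrow> x * y \<in> R"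
  shows "subdom R"
proof -
  interpret field "ring_of_type_algebra :: 'a ring" by (rule field_from_type_algebra)
  have 0: "0 \<in> R" using assms(1) assms(2)[of 1 1] by simp
  have neg: "- x \<in> R" if "x \<in> R" for x using assms(2)[OF 0 that] by simp
  have add: "x + y \<in> R" if "x \<in> R" "y \<in> R" for x y
    using assms(2)[OF that(1) neg[OF that(2)]] by simp
  show ?thesis
    by (intro subdomainI' subringI) (use assms neg add in auto)
qed

context
  fixes R :: "'k::field set"
  assumes R: "subdom R"
begin

lemma subdom_0: "0 \<in> R" and subdom_1: "1 \<in> R"
  and subdom_uminus: "x \<in> R \<Longrightarrow> - x \<in> R"
  and subdom_mult: "x \<in> R \<Longrightarrow> y \<in> R \<Longrightarrow> x * y \<in> R"
  and subdom_add: "x \<in> R \<Longrightarrow> y \<in> R \<Longrightarrow> x + y \<in> R"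
  using subdomainE(2,3,5,6,7)[OF R] by auto

lemma subdom_diff: "x \<in> R \<Longrightarrow> y \<in> R \<Longrightarrow> x - y \<in> R"
  using subdom_add[of x "- y"] subdom_uminus by simp

lemma subdom_power: "x \<in> R \<Longrightarrow> x ^ n \<in> R"
  by (induction n) (auto intro: subdom_1 subdom_mult)

lemma subdom_sum: "(\<And>i. i \<in> I \<Longrightarrow> f i \<in> R) \<Longrightarrow> sum f I \<in> R"
  by (induction I rule: infinite_finite_induct) (auto intro: subdom_0 subdom_add)

lemma subdom_of_nat: "of_nat n \<in> R"
  by (induction n) (auto intro: subdom_0 subdom_1 subdom_add)

lemma cring_ring_on: "cring (ring_on R)"
proof -
  interpret field "ring_of_type_algebra :: 'k ring" by (rule field_from_type_algebra)
  show ?thesis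
    using subcring_iff[OF subdomainE(1)[OF R]] subdomain.axioms(1)[OF R] by blast
qed

lemma ring_ring_on: "ring (ring_on R)"
  using cring_ring_on by (rule cring.axioms(1))

text \<open>Closure under negation is multiplication by \<open>- 1\<close>, which is why the
  elementwise description mentions only zero, sums and multiples.\<close>

lemma ideal_ring_on_iff:
  "ideal I (ring_on R) \<longleftrightarrow>
     I \<subseteq> R \<and> 0 \<in> I \<and> (\<forall>x\<in>I. \<forall>y\<in>I. x + y \<in> I) \<and> (\<forall>x\<in>R. \<forall>y\<in>I. x * y \<in> I)"
  (is "?L \<longleftrightarrow> ?R")
proof
  assume ?L
  then interpret ideal I "ring_on R" .
  show ?R
    using a_subset additive_subgroup.zero_closed[OF is_additive_subgroup]
      additive_subgroup.a_closed[OF is_additive_subgroup] I_l_closed by auto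
next
  assume ?R
  have neg: "- x \<in> I" if "x \<in> I" for x
  proof -
    have "- 1 * x \<in> I" using \<open>?R\<close> that subdom_uminus[OF subdom_1] by blast
    then show ?thesis by simp
  qed
  interpret ring "ring_on R" by (rule ring_ring_on)
  have inv: "\<ominus>\<^bsub>ring_on R\<^esub> x = - x" if "x \<in> R" for x
    by (rule minus_equality) (use that subdom_uminus in auto)
  show ?L
  proof (rule idealI[OF ring_ring_on])
    show "subgroup I (add_monoid (ring_on R))"
      using \<open>?R\<close> neg inv by (intro add.subgroupI) (auto simp flip: a_inv_def)
  next
    fix a x assume "a \<in> I" "x \<in> carrier (ring_on R)"
    then have "x * a \<in> I" using \<open>?R\<close> by auto
    then show "x \<otimes>\<^bsub>ring_on R\<^esub> a \<in> I" "a \<otimes>\<^bsub>ring_on R\<^esub> x \<in> I"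
      by (simp_all add: mult.commute)
  qed
qed

lemma primeideal_ring_on_iff:
  "primeideal I (ring_on R) \<longleftrightarrow>
     ideal I (ring_on R) \<and> 1 \<notin> I \<and> (\<forall>x\<in>R. \<forall>y\<in>R. x * y \<in> I \<longrightarrow> x \<in> I \<or> y \<in> I)"
  (is "?L \<longleftrightarrow> ?R")
proof
  assume ?L
  then interpret primeideal I "ring_on R" .
  show ?R
    using is_ideal I_notcarr one_imp_carrier I_prime by auto
next
  assume ?R
  then show ?L
    using subdom_1 cring_ring_on by (intro primeidealI) auto
qed

text \<open>The ideal generated by \<open>I\<close> and \<open>x\<close>. It serves as the test
  ideal for maximality, both in the criterion below and in the Zorn argument for central lying
  over.\<close>

lemma ideal_add_principal:
  assumes "ideal I (ring_on R)" and x: "x \<in> R"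
  shows "ideal {x * y + z | y z. y \<in> R \<and> z \<in> I} (ring_on R)" (is "ideal ?J _")
    and "I \<subseteq> {x * y + z | y z. y \<in> R \<and> z \<in> I}" and "x \<in> {x * y + z | y z. y \<in> R \<and> z \<in> I}"
proof -
  have I: "I \<subseteq> R" "0 \<in> I" "\<And>x y. x \<in> I \<Longrightarrow> y \<in> I \<Longrightarrow> x + y \<in> I" "\<And>x y. x \<in> R \<Longrightarrow> y \<in> I \<Longrightarrow> x * y \<in> I"
    using assms(1) by (auto simp: ideal_ring_on_iff)
  show "ideal ?J (ring_on R)"
    unfolding ideal_ring_on_iff
  proof (intro conjI ballI)
    show "?J \<subseteq> R" using x I(1) by (auto intro!: subdom_add subdom_mult)
    show "0 \<in> ?J" using I(2) subdom_0 by (intro CollectI exI[of _ 0]) simp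
    show "a + b \<in> ?J" if ab: "a \<in> ?J" "b \<in> ?J" for a b
    proof -
      obtain y z y' z' where "a = x * y + z" "b = x * y' + z'" "y \<in> R" "z \<in> I" "y' \<in> R" "z' \<in> I"
        using ab by blast
      moreover from this have "a + b = x * (y + y') + (z + z')" by (simp add: algebra_simps)
      ultimately show ?thesis using I(3)[of z z'] subdom_add[of y y'] by blast
    qed
    show "r * a \<in> ?J" if ra: "r \<in> R" "a \<in> ?J" for r a
    proof -
      obtain y z where "a = x * y + z" "y \<in> R" "z \<in> I" using ra by blast
      moreover from this have "r * a = x * (r * y) + r * z" by (simp add: algebra_simps)
      ultimately show ?thesis using I(4)[of r z] subdom_mult[of r y] ra(1) by blast
    qed
  qed
  show "I \<subseteq> ?J"
  proof
    fix z assume "z \<in> I"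
    then show "z \<in> ?J" using subdom_0 by (intro CollectI exI[of _ 0] exI[of _ z]) simp
  qed
  show "x \<in> ?J" using I(2) subdom_1 by (intro CollectI exI[of _ 1] exI[of _ 0]) simp
qed

text \<open>Maximality in the form used later: every element outside \<open>I\<close> is invertible
  modulo \<open>I\<close>, since it generates the unit ideal together with \<open>I\<close>.\<close>

lemma maximalideal_ring_on_iff:
  "maximalideal I (ring_on R) \<longleftrightarrow>
     ideal I (ring_on R) \<and> 1 \<notin> I \<and> (\<forall>x\<in>R - I. \<exists>y\<in>R. \<exists>z\<in>I. x * y + z = 1)"
  (is "?L \<longleftrightarrow> ?R")
proof
  assume ?L
  then interpret maximalideal I "ring_on R" .
  have "\<exists>y\<in>R. \<exists>z\<in>I. x * y + z = 1" if x: "x \<in> R" "x \<notin> I" for x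
  proof -
    let ?J = "{x * y + z | y z. y \<in> R \<and> z \<in> I}"
    note J = ideal_add_principal[OF is_ideal x(1)]
    have "?J \<subseteq> R" using J(1) by (simp add: ideal_ring_on_iff)
    then have "?J = I \<or> ?J = R" using I_maximal[OF J(1,2)] by simp
    then have "1 \<in> ?J" using J(3) x(2) subdom_1 by blast
    then show ?thesis by force
  qed
  then show ?R
    using is_ideal I_notcarr one_imp_carrier by auto
next
  assume r: ?R
  show ?L
  proof (rule maximalidealI)
    show "ideal I (ring_on R)" using r by blast
    show "carrier (ring_on R) \<noteq> I" using r subdom_1 by auto
    fix J assume J: "ideal J (ring_on R)" "I \<subseteq> J" "J \<subseteq> carrier (ring_on R)"
    show "J = I \<or> J = carrier (ring_on R)"
    proof (cases "J = I")
      case False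
      then obtain x where x: "x \<in> J" "x \<notin> I" using J by blast
      obtain y z where yz: "y \<in> R" "z \<in> I" "x * y + z = 1"
      proof -
        have "x \<in> R - I" using x J(3) by auto
        then show ?thesis using r that by blast
      qed
      have j: "\<forall>x\<in>J. \<forall>y\<in>J. x + y \<in> J" "\<forall>x\<in>R. \<forall>y\<in>J. x * y \<in> J"
        using J(1) by (auto simp: ideal_ring_on_iff)
      have "y * x \<in> J" "z \<in> J" using j x yz J(2) by auto
      then have "y * x + z \<in> J" using j by blast
      then have "1 \<in> J" using yz(3) by (simp add: mult.commute)
      then have "r \<in> J" if "r \<in> R" for r using j(2) that by (metis mult.right_neutral)
      then have "J = R" using J(3) by auto
      then show ?thesis by simp
    qed simp
  qed
qed

lemma maximalideal_imp_primeideal: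
  assumes "maximalideal I (ring_on R)" shows "primeideal I (ring_on R)"
  using cring.maximalideal_prime[OF cring_ring_on assms] .

lemma idealD:
  assumes "ideal I (ring_on R)"
  shows "I \<subseteq> R" "0 \<in> I" "x \<in> I \<Longrightarrow> y \<in> I \<Longrightarrow> x + y \<in> I" "x \<in> R \<Longrightarrow> y \<in> I \<Longrightarrow> x * y \<in> I"
    "x \<in> I \<Longrightarrow> y \<in> R \<Longrightarrow> x * y \<in> I" "x \<in> I \<Longrightarrow> - x \<in> I" "x \<in> I \<Longrightarrow> y \<in> I \<Longrightarrow> x - y \<in> I"
proof -
  show 1: "I \<subseteq> R" "0 \<in> I" "\<And>x y. x \<in> I \<Longrightarrow> y \<in> I \<Longrightarrow> x + y \<in> I" "\<And>x y. x \<in> R \<Longrightarrow> y \<in> I \<Longrightarrow> x * y \<in> I"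
    using assms by (auto simp: ideal_ring_on_iff)
  show "x \<in> I \<Longrightarrow> y \<in> R \<Longrightarrow> x * y \<in> I" using 1(4)[of y x] by (simp add: mult.commute)
  show 2: "\<And>x. x \<in> I \<Longrightarrow> - x \<in> I" using 1(4)[OF subdom_uminus[OF subdom_1]] by simp
  show "x \<in> I \<Longrightarrow> y \<in> I \<Longrightarrow> x - y \<in> I" using 1(3)[of x "- y"] 2 by simp
qed

lemma primeidealD:
  assumes "primeideal I (ring_on R)"
  shows "ideal I (ring_on R)" "1 \<notin> I" "x \<in> R \<Longrightarrow> y \<in> R \<Longrightarrow> x * y \<in> I \<Longrightarrow> x \<in> I \<or> y \<in> I"
    "x \<in> R \<Longrightarrow> x ^ n \<in> I \<Longrightarrow> x \<in> I" "x \<in> R - I \<Longrightarrow> y \<in> R - I \<Longrightarrow> x * y \<in> R - I"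
    "x \<in> R - I \<Longrightarrow> x \<noteq> 0"
proof -
  show 1: "ideal I (ring_on R)" "1 \<notin> I"
    "\<And>x y. x \<in> R \<Longrightarrow> y \<in> R \<Longrightarrow> x * y \<in> I \<Longrightarrow> x \<in> I \<or> y \<in> I"
    using assms by (auto simp: primeideal_ring_on_iff)
  show "x \<in> I" if "x \<in> R" "x ^ n \<in> I"
    using that(2)
  proof (induction n)
    case (Suc n)
    then show ?case using 1(3)[of x "x ^ n"] that(1) subdom_power by auto
  qed (use 1(2) in simp)
  show "x \<in> R - I \<Longrightarrow> y \<in> R - I \<Longrightarrow> x * y \<in> R - I"
    using 1(3)[of x y] subdom_mult[of x y] by simp blast
  show "x \<in> R - I \<Longrightarrow> x \<noteq> 0" using idealD(2)[OF 1(1)] by auto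
qed

end

lemma primeideal_contract:
  assumes "subdom R" "subdom S" "R \<subseteq> S" "primeideal q (ring_on S)"
  shows "primeideal (q \<inter> R) (ring_on R)"
proof -
  note q = primeidealD[OF assms(2,4)] note I = idealD[OF assms(2) q(1)]
  show ?thesis
    unfolding primeideal_ring_on_iff[OF assms(1)] ideal_ring_on_iff[OF assms(1)]
  proof (intro conjI ballI impI)
    fix x y assume "x \<in> R" "y \<in> R" "x * y \<in> q \<inter> R"
    then show "x \<in> q \<inter> R \<or> y \<in> q \<inter> R" using q(3)[of x y] assms(3) by auto
  next
    fix x y assume "x \<in> R" "y \<in> q \<inter> R"
    then show "x * y \<in> q \<inter> R" using I(4)[of x y] assms(3) subdom_mult[OF assms(1), of x y] by auto
  qed (use I(2,3) q(2) subdom_0[OF assms(1)] subdom_add[OF assms(1)] in auto)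
qed

section \<open>Localization at a prime of the base ring\<close>

lemma locI: "m \<in> M \<Longrightarrow> s \<in> R \<Longrightarrow> s \<notin> p \<Longrightarrow> m / s \<in> loc R p M"
  by (auto simp: loc_def)

lemma locE:
  assumes "x \<in> loc R p M"
  obtains m s where "m \<in> M" "s \<in> R" "s \<notin> p" "x = m / s"
  using assms by (auto simp: loc_def)

lemma subset_loc:
  assumes R: "subdom R" and p: "primeideal p (ring_on R)"
  shows "M \<subseteq> loc R p M"
  using locI[of _ M 1 R p] primeidealD(2)[OF R p] subdom_1[OF R] by auto

context
  fixes R S p :: "'k::field set"
  assumes R: "subdom R" and S: "subdom S" and RS: "R \<subseteq> S" and p: "primeideal p (ring_on R)"
begin

lemma subdom_loc: "subdom (loc R p S)"
proof (rule subdomI)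
  show "1 \<in> loc R p S" using subset_loc[OF R p] subdom_1[OF S] by blast
  fix x y assume "x \<in> loc R p S" "y \<in> loc R p S"
  then obtain a s b t where *: "a \<in> S" "b \<in> S" "s \<in> R - p" "t \<in> R - p" "x = a / s" "y = b / t"
    by (auto elim!: locE)
  then have st: "s \<noteq> 0" "t \<noteq> 0" "s * t \<in> R - p" "s \<in> S" "t \<in> S"
    using primeidealD[OF R p] RS by auto
  have "x - y = (a * t - b * s) / (s * t)" using * st by (simp add: field_simps)
  moreover have "a * t - b * s \<in> S" using * st S by (intro subdom_diff subdom_mult) auto
  ultimately show "x - y \<in> loc R p S" using st locI[of _ S "s * t" R p] by auto
  have "x * y = (a * b) / (s * t)" using * st by (simp add: field_simps)
  moreover have "a * b \<in> S" using * S by (intro subdom_mult) auto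
  ultimately show "x * y \<in> loc R p S" using st locI[of _ S "s * t" R p] by auto
qed

lemma ideal_loc:
  assumes I: "ideal I (ring_on S)"
  shows "ideal (loc R p I) (ring_on (loc R p S))"
  unfolding ideal_ring_on_iff[OF subdom_loc]
proof (intro conjI ballI)
  note I = idealD[OF S I]
  show "loc R p I \<subseteq> loc R p S" using I(1) by (auto simp: loc_def)
  show "0 \<in> loc R p I" using I(2) subset_loc[OF R p, of I] by blast
  fix x y assume "x \<in> loc R p I" "y \<in> loc R p I"
  then obtain a s b t where *: "a \<in> I" "b \<in> I" "s \<in> R - p" "t \<in> R - p" "x = a / s" "y = b / t"
    by (auto elim!: locE)
  then have st: "s \<noteq> 0" "t \<noteq> 0" "s * t \<in> R - p" "s \<in> S" "t \<in> S"
    using primeidealD[OF R p] RS by auto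
  have "x + y = (a * t + b * s) / (s * t)" using * st by (simp add: field_simps)
  moreover have "a * t + b * s \<in> I" using * st I(3)[of "a * t" "b * s"] I(5) by auto
  ultimately show "x + y \<in> loc R p I" using st locI[of _ I "s * t" R p] by auto
next
  note I = idealD[OF S I]
  fix x y assume "x \<in> loc R p S" "y \<in> loc R p I"
  then obtain a s b t where *: "a \<in> S" "b \<in> I" "s \<in> R - p" "t \<in> R - p" "x = a / s" "y = b / t"
    by (auto elim!: locE)
  then have st: "s \<noteq> 0" "t \<noteq> 0" "s * t \<in> R - p"
    using primeidealD[OF R p] RS by auto
  have "x * y = (a * b) / (s * t)" using * st by (simp add: field_simps)
  moreover have "a * b \<in> I" using * I(4) by auto
  ultimately show "x * y \<in> loc R p I" using st locI[of _ I "s * t" R p] by auto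
qed

text \<open>Clear the denominator \<open>s\<close>: it avoids \<open>p\<close>, hence also
  \<open>q\<close> because \<open>q \<inter> R \<subseteq> p\<close>, and so it cancels by
  primality. Localizing therefore loses no information about \<open>q\<close>.\<close>

lemma loc_prime_mem:
  assumes q: "primeideal q (ring_on S)" and qp: "q \<inter> R \<subseteq> p" and x: "x \<in> S" "x \<in> loc R p q"
  shows "x \<in> q"
proof -
  obtain m s where ms: "m \<in> q" "s \<in> R - p" "x = m / s" using x by (auto elim!: locE)
  then have "x * s \<in> q" using primeidealD(6)[OF R p, of s] by auto
  then show ?thesis using primeidealD(3)[OF S q, of x s] x ms RS qp by auto
qed

lemma primeideal_loc:
  assumes q: "primeideal q (ring_on S)" and qp: "q \<inter> R \<subseteq> p"
  shows "primeideal (loc R p q) (ring_on (loc R p S))"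
  unfolding primeideal_ring_on_iff[OF subdom_loc]
proof (intro conjI ballI impI)
  note Q = primeidealD[OF S q] note I = idealD[OF S Q(1)]
  show "ideal (loc R p q) (ring_on (loc R p S))" by (rule ideal_loc[OF Q(1)])
  show "1 \<notin> loc R p q" using loc_prime_mem[OF q qp subdom_1[OF S]] Q(2) by blast
  fix x y assume x: "x \<in> loc R p S" and y: "y \<in> loc R p S" and xy: "x * y \<in> loc R p q"
  obtain a s b t where *: "a \<in> S" "b \<in> S" "s \<in> R - p" "t \<in> R - p" "x = a / s" "y = b / t"
    using x y by (auto elim!: locE)
  then have st: "s \<noteq> 0" "t \<noteq> 0" "s * t \<in> R - p" "s \<in> S" "t \<in> S"
    using primeidealD[OF R p] RS by auto
  have "s * t \<in> loc R p S" using subset_loc[OF R p] subdom_mult[OF S st(4,5)] by blast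
  then have "(s * t) * (x * y) \<in> loc R p q"
    using idealD(4)[OF subdom_loc ideal_loc[OF Q(1)]] xy by blast
  then have "a * b \<in> loc R p q" using * st by simp
  then have "a * b \<in> q" using loc_prime_mem[OF q qp subdom_mult[OF S *(1,2)]] by blast
  then have "a \<in> q \<or> b \<in> q" using Q(3) * by auto
  then show "x \<in> loc R p q \<or> y \<in> loc R p q" using * locI[of _ q _ R p] by auto
qed

end

section \<open>Sums of squares and integral elements\<close>

lemma subset_frac_field_of: "1 \<in> R \<Longrightarrow> R \<subseteq> frac_field_of R"
  by (force simp: frac_field_of_def)

lemma frac_field_of_mono: "R \<subseteq> S \<Longrightarrow> frac_field_of R \<subseteq> frac_field_of S"
  by (auto simp: frac_field_of_def)

lemma frac_field_ofI: "a \<in> R \<Longrightarrow> b \<in> R \<Longrightarrow> b \<noteq> 0 \<Longrightarrow> a / b \<in> frac_field_of R"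
  by (auto simp: frac_field_of_def)

lemma frac_field_ofE:
  assumes "x \<in> frac_field_of R" obtains a b where "a \<in> R" "b \<in> R" "b \<noteq> 0" "x = a / b"
  using assms by (auto simp: frac_field_of_def)

lemma subdom_frac_field_of:
  assumes R: "subdom R" shows "subdom (frac_field_of R)"
proof (rule subdomI)
  show "1 \<in> frac_field_of R" using subset_frac_field_of subdom_1[OF R] by blast
  fix x y assume x: "x \<in> frac_field_of R" and y: "y \<in> frac_field_of R"
  obtain a b where ab: "a \<in> R" "b \<in> R" "b \<noteq> 0" "x = a / b" using x by (rule frac_field_ofE)
  obtain c d where cd: "c \<in> R" "d \<in> R" "d \<noteq> 0" "y = c / d" using y by (rule frac_field_ofE)
  have "x - y = (a * d - c * b) / (b * d)" "x * y = (a * c) / (b * d)"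
    using ab cd by (simp_all add: field_simps)
  moreover have "a * d - c * b \<in> R" "a * c \<in> R" "b * d \<in> R" "b * d \<noteq> 0"
    using ab cd R by (auto intro!: subdom_diff subdom_mult)
  ultimately show "x - y \<in> frac_field_of R" "x * y \<in> frac_field_of R"
    by (auto intro: frac_field_ofI)
qed

lemma frac_field_of_divide:
  assumes R: "subdom R" and x: "x \<in> frac_field_of R" and y: "y \<in> frac_field_of R"
  shows "x / y \<in> frac_field_of R"
proof (cases "y = 0")
  case True
  then show ?thesis using subdom_0[OF subdom_frac_field_of[OF R]] by simp
next
  case False
  obtain a b where ab: "a \<in> R" "b \<in> R" "b \<noteq> 0" "x = a / b" using x by (rule frac_field_ofE)
  obtain c d where cd: "c \<in> R" "d \<in> R" "d \<noteq> 0" "y = c / d" using y by (rule frac_field_ofE)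
  have "x / y = (a * d) / (b * c)" using ab cd by simp
  moreover have "b * c \<noteq> 0" using False ab cd by simp
  ultimately show ?thesis using ab cd frac_field_ofI[of "a * d" R "b * c"] subdom_mult[OF R] by simp
qed

lemma frac_field_of_eq:
  assumes R: "subdom R" and RS: "R \<subseteq> S" and SF: "S \<subseteq> frac_field_of R"
  shows "frac_field_of S = frac_field_of R"
proof
  show "frac_field_of S \<subseteq> frac_field_of R"
  proof
    fix x assume "x \<in> frac_field_of S"
    then obtain a b where "a \<in> S" "b \<in> S" "x = a / b" by (rule frac_field_ofE)
    then show "x \<in> frac_field_of R" using frac_field_of_divide[OF R] SF by blast
  qed
qed (rule frac_field_of_mono[OF RS])

section \<open>Closure properties of the cone of sums of squares\<close>

lemma sums_of_squares_induct [consumes 1, case_names 0 add]: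
  assumes "t \<in> sums_of_squares F" "P 0"
    and "\<And>x s. x \<in> F \<Longrightarrow> s \<in> sums_of_squares F \<Longrightarrow> P s \<Longrightarrow> P (x ^ 2 + s)"
  shows "P t"
proof -
  obtain xs where xs: "set xs \<subseteq> F" and t: "t = (\<Sum>x\<leftarrow>xs. x ^ 2)"
    using assms(1) by (auto simp: sums_of_squares_def)
  from xs show ?thesis
    unfolding t
  proof (induction xs)
    case (Cons a xs)
    then have "(\<Sum>x\<leftarrow>xs. x ^ 2) \<in> sums_of_squares F" by (auto simp: sums_of_squares_def)
    then show ?case using assms(3)[of a "\<Sum>x\<leftarrow>xs. x ^ 2"] Cons by simp
  qed (use assms(2) in simp)
qed

lemma sums_of_squares_0: "0 \<in> sums_of_squares F"
  by (auto simp: sums_of_squares_def intro!: exI[of _ "[]"])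

lemma sums_of_squares_square_add:
  assumes "x \<in> F" "s \<in> sums_of_squares F" shows "x ^ 2 + s \<in> sums_of_squares F"
proof -
  obtain xs where "set xs \<subseteq> F" "s = (\<Sum>x\<leftarrow>xs. x ^ 2)"
    using assms(2) by (auto simp: sums_of_squares_def)
  then show ?thesis using assms(1) by (auto simp: sums_of_squares_def intro!: exI[of _ "x # xs"])
qed

lemma sums_of_squares_square: "x \<in> F \<Longrightarrow> x ^ 2 \<in> sums_of_squares F"
  using sums_of_squares_square_add[OF _ sums_of_squares_0] by force

lemma sums_of_squares_add:
  assumes "s \<in> sums_of_squares F" "t \<in> sums_of_squares F" shows "s + t \<in> sums_of_squares F"
  using assms(1)
proof (induction rule: sums_of_squares_induct)
  case (add x s)
  then show ?case using sums_of_squares_square_add[of x F "s + t"] by (simp add: add.assoc)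
qed (use assms(2) in simp)

lemma sums_of_squares_sum:
  "(\<And>i. i \<in> I \<Longrightarrow> f i \<in> sums_of_squares F) \<Longrightarrow> sum f I \<in> sums_of_squares F"
  by (induction I rule: infinite_finite_induct) (auto intro: sums_of_squares_0 sums_of_squares_add)

lemma sums_of_squares_subset:
  assumes F: "subdom F" shows "sums_of_squares F \<subseteq> F"
proof
  fix t assume "t \<in> sums_of_squares F"
  then show "t \<in> F"
    by (induction rule: sums_of_squares_induct) (auto intro: subdom_0 subdom_add subdom_power F)
qed

lemma sums_of_squares_mono: "F \<subseteq> G \<Longrightarrow> sums_of_squares F \<subseteq> sums_of_squares G"
  by (auto simp: sums_of_squares_def)

lemma sums_of_squares_mult:
  assumes F: "subdom F" and "s \<in> sums_of_squares F" "t \<in> sums_of_squares F"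
  shows "s * t \<in> sums_of_squares F"
  using assms(2)
proof (induction rule: sums_of_squares_induct)
  case (add x s)
  have "x ^ 2 * t \<in> sums_of_squares F"
    using assms(3)
  proof (induction rule: sums_of_squares_induct)
    case (add y u)
    have "x ^ 2 * (y ^ 2 + u) = (x * y) ^ 2 + x ^ 2 * u" by (simp add: algebra_simps)
    then show ?case
      using sums_of_squares_square_add[OF _ add(3), of "x * y"] subdom_mult[OF F \<open>x \<in> F\<close> add(1)]
      by simp
  qed (simp add: sums_of_squares_0)
  then show ?case using add(3) by (simp add: distrib_right sums_of_squares_add)
qed (simp add: sums_of_squares_0)

lemma sums_of_squares_1: "subdom F \<Longrightarrow> 1 \<in> sums_of_squares F"
  using sums_of_squares_square[of 1 F] subdom_1 by fastforce

lemma sums_of_squares_power: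
  "subdom F \<Longrightarrow> t \<in> sums_of_squares F \<Longrightarrow> t ^ n \<in> sums_of_squares F"
  by (induction n) (auto intro: sums_of_squares_1 sums_of_squares_mult)

lemma sums_of_squares_of_nat: "subdom F \<Longrightarrow> of_nat n \<in> sums_of_squares F"
  by (induction n) (auto intro: sums_of_squares_0 sums_of_squares_1 sums_of_squares_add)

text \<open>The cone is closed under division because \<open>s / t = s * t * (1 / t) ^ 2\<close>.
  For \<open>t = 0\<close> both sides are 0.\<close>

lemma sums_of_squares_frac_divide:
  assumes R: "subdom R" and s: "s \<in> sums_of_squares (frac_field_of R)"
    and t: "t \<in> sums_of_squares (frac_field_of R)"
  shows "s / t \<in> sums_of_squares (frac_field_of R)"
proof -
  note F = subdom_frac_field_of[OF R]
  have "1 / t \<in> frac_field_of R"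
    using frac_field_of_divide[OF R subdom_1[OF F], of t] sums_of_squares_subset[OF F] t by blast
  then have "s * t * (1 / t) ^ 2 \<in> sums_of_squares (frac_field_of R)"
    by (intro sums_of_squares_mult F s t sums_of_squares_square)
  moreover have "s * t * (1 / t) ^ 2 = s / t" by (simp add: power2_eq_square)
  ultimately show ?thesis by simp
qed

section \<open>Inequalities modulo sums of squares: read x \<le> y as saying that y - x is a sum of
  squares\<close>

context
  fixes F :: "'k::field set"
  assumes F: "subdom F"
begin

private abbreviation (input) "T \<equiv> sums_of_squares F"

private lemmas T_intros = sums_of_squares_0 sums_of_squares_1[OF F] sums_of_squares_add
  sums_of_squares_mult[OF F] sums_of_squares_power[OF F] sums_of_squares_of_nat[OF F]
  sums_of_squares_sum

text \<open>Lagrange's identity: the difference is the sum of all \<open>(z i - z j) ^ 2\<close>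
  over pairs i < j. The induction step adds the pairs that contain the new index.\<close>

lemma sums_of_squares_Cauchy_Schwarz:
  assumes "\<And>i. i < n \<Longrightarrow> z i \<in> F"
  shows "of_nat n * (\<Sum>i<n. z i ^ 2) - (\<Sum>i<n. z i) ^ 2 \<in> T"
  using assms
proof (induction n)
  case (Suc n)
  let ?Z = "\<Sum>i<n. z i" and ?S = "\<Sum>i<n. z i ^ 2"
  have "(\<Sum>i<n. (z i - z n) ^ 2) = (\<Sum>i<n. z i ^ 2 - 2 * z n * z i + z n ^ 2)"
    by (intro sum.cong) (auto simp: power2_eq_square algebra_simps)
  also have "\<dots> = ?S - 2 * z n * ?Z + of_nat n * z n ^ 2"
    by (simp add: sum.distrib sum_subtractf sum_distrib_left)
  finally have "of_nat (Suc n) * (\<Sum>i<Suc n. z i ^ 2) - (\<Sum>i<Suc n. z i) ^ 2 =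
      (of_nat n * ?S - ?Z ^ 2) + (\<Sum>i<n. (z i - z n) ^ 2)"
    by (simp add: power2_eq_square algebra_simps)
  moreover have "(\<Sum>i<n. (z i - z n) ^ 2) \<in> T"
    using Suc.prems by (intro sums_of_squares_sum sums_of_squares_square subdom_diff[OF F]) auto
  ultimately show ?case using Suc by (simp add: sums_of_squares_add)
qed (simp add: sums_of_squares_0)

text \<open>With N = j + m the expression equals (1 - w^j)(1 - w^m) + w^m. Both factors of the
  product are multiples of 1 - w by geometric sums, so the product is \<open>(1 - w) ^ 2\<close>
  times an element of the cone, and no comparison of \<open>w\<close> with 1 is needed.\<close>

lemma sums_of_squares_power_le:
  assumes w: "w \<in> T" and "j \<le> N"
  shows "1 + w ^ N - w ^ j \<in> T"
proof -
  obtain m where N: "N = j + m" using assms(2) le_Suc_ex by blast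
  have "1 + w ^ N - w ^ j = (1 - w ^ j) * (1 - w ^ m) + w ^ m"
    by (simp add: N power_add algebra_simps)
  also have "(1 - w ^ j) * (1 - w ^ m) = (1 - w) ^ 2 * ((\<Sum>i<j. w ^ i) * (\<Sum>i<m. w ^ i))"
    by (simp add: one_diff_power_eq power2_eq_square algebra_simps)
  finally show ?thesis
    using w sums_of_squares_subset[OF F]
    by (auto intro!: T_intros sums_of_squares_square subdom_diff[OF F] subdom_1[OF F])
qed

lemma sums_of_squares_power_diff_1:
  assumes l: "l \<in> T" "l - 1 \<in> T"
  shows "l ^ n - 1 \<in> T"
proof (induction n)
  case (Suc n)
  have eq: "l ^ Suc n - 1 = l * (l ^ n - 1) + (l - 1)" by (simp add: algebra_simps)
  show ?case
    unfolding eq by (rule sums_of_squares_add[OF sums_of_squares_mult[OF F l(1) Suc] l(2)])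
qed (simp add: sums_of_squares_0)

end

text \<open>The cone of sums of squares is only a partial order, so the usual case distinction on the size of
  \<open>w\<close> is replaced by \<open>l\<^sup>k\<^sup>-\<^sup>j w\<^sup>j \<le> l\<^sup>k + w\<^sup>k\<close>, summed over \<open>j < k\<close>.\<close>

lemma Cauchy_root_bound:
  assumes R: "subdom R" and real: "real_domain R" and w: "w \<in> sums_of_squares (frac_field_of R)"
    and e: "\<And>i. i < k \<Longrightarrow> e i \<in> R \<inter> sums_of_squares (frac_field_of R)"
    and le: "(\<Sum>i<k. e i * w ^ i) - w ^ k \<in> sums_of_squares (frac_field_of R)"
    and k: "k > 0"
  shows "\<exists>D \<in> R \<inter> sums_of_squares (frac_field_of R). D - w \<in> sums_of_squares (frac_field_of R)"
proof -
  define F where "F = frac_field_of R"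
  let ?T = "sums_of_squares F"
  have F: "subdom F" unfolding F_def by (rule subdom_frac_field_of[OF R])
  note T = sums_of_squares_0 sums_of_squares_1[OF F] sums_of_squares_add
    sums_of_squares_mult[OF F] sums_of_squares_power[OF F] sums_of_squares_of_nat[OF F]
    sums_of_squares_sum
  have w: "w \<in> ?T" and e: "\<And>i. i < k \<Longrightarrow> e i \<in> R" "\<And>i. i < k \<Longrightarrow> e i \<in> ?T"
    and le: "(\<Sum>i<k. e i * w ^ i) - w ^ k \<in> ?T"
    using assms by (auto simp: F_def)
  \<comment> \<open>\<open>E\<close> is chosen so that \<open>E\<close> and all
    \<open>E - e j\<close> are sums of squares. With l = 2kE this gives 2k w^k \<le> 2k (sum of e_j
    w^j) \<le> l (sum of w^j) \<le> k l^k + k w^k, and the factor 2 leaves k w^k \<le> k l^k. The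
    three inequalities are added up at once below.\<close>
  define E where "E = 1 + (\<Sum>i<k. e i)"
  define l where "l = of_nat (2 * k) * E"
  have E: "E \<in> R" "E \<in> ?T" unfolding E_def using e
    by (auto intro!: subdom_add[OF R] subdom_1[OF R] subdom_sum[OF R] T)
  have l: "l \<in> R" "l \<in> ?T" unfolding l_def using E
    by (auto intro!: subdom_mult[OF R] subdom_of_nat[OF R] T simp del: of_nat_mult)
  have "l - 1 = of_nat (2 * k - 1) + of_nat (2 * k) * (\<Sum>i<k. e i)"
    using k by (simp add: l_def E_def algebra_simps of_nat_diff)
  also have "\<dots> \<in> ?T" using e by (auto intro!: T simp del: of_nat_mult)
  finally have l1: "l - 1 \<in> ?T" .
  \<comment> \<open>Were \<open>l\<close> zero, \<open>l - 1\<close> would exhibit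
    \<open>- 1\<close> as a sum of squares. This is where reality enters.\<close>
  have l0: "l \<noteq> 0" using l1 real by (auto simp: real_domain_def F_def)
  \<comment> \<open>Apply the power inequality to \<open>w / l\<close> and scale by
    \<open>l ^ k\<close>, which gives \<open>l ^ (k - j) * w ^ j\<close> in place of
    \<open>l * w ^ j\<close>. Since k - j \<ge> 1 and l \<ge> 1, the surplus power of
    \<open>l\<close> may be dropped.\<close>
  have "l ^ k + w ^ k - l * w ^ j \<in> ?T" if j: "j < k" for j
  proof -
    have "w / l \<in> ?T" unfolding F_def
      by (rule sums_of_squares_frac_divide[OF R]) (use w l in \<open>auto simp: F_def\<close>)
    then have "l ^ k * (1 + (w / l) ^ k - (w / l) ^ j) \<in> ?T"
      using j l by (intro T sums_of_squares_power_le[OF F]) auto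
    moreover have "l ^ k * (1 + (w / l) ^ k - (w / l) ^ j) = l ^ k + w ^ k - l ^ (k - j) * w ^ j"
      using l0 j by (simp add: field_simps power_diff)
    moreover have "l * (l ^ (k - j - 1) - 1) * w ^ j \<in> ?T"
      using l l1 w by (intro T sums_of_squares_power_diff_1[OF F])
    moreover have "l * (l ^ (k - j - 1) - 1) * w ^ j = l ^ (k - j) * w ^ j - l * w ^ j"
      using j by (simp add: algebra_simps power_eq_if)
    ultimately show ?thesis using sums_of_squares_add by fastforce
  qed
  then have "(\<Sum>j<k. l ^ k + w ^ k - l * w ^ j) \<in> ?T" by (intro T) auto
  moreover have "(\<Sum>j<k. of_nat (2 * k) * ((E - e j) * w ^ j)) \<in> ?T"
  proof (rule sums_of_squares_sum)
    fix j assume j: "j \<in> {..<k}"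
    have "E - e j = 1 + sum e ({..<k} - {j})"
      using j by (simp add: E_def sum_diff1)
    also have "\<dots> \<in> ?T" using e by (intro T) auto
    finally show "of_nat (2 * k) * ((E - e j) * w ^ j) \<in> ?T" using w by (intro T)
  qed
  moreover have "of_nat (2 * k) * ((\<Sum>i<k. e i * w ^ i) - w ^ k) \<in> ?T" using le by (intro T)
  ultimately have "(\<Sum>j<k. l ^ k + w ^ k - l * w ^ j) +
      ((\<Sum>j<k. of_nat (2 * k) * ((E - e j) * w ^ j)) +
      of_nat (2 * k) * ((\<Sum>i<k. e i * w ^ i) - w ^ k)) \<in> ?T"
    by (intro sums_of_squares_add)
  also have "(\<Sum>j<k. l ^ k + w ^ k - l * w ^ j) +
      ((\<Sum>j<k. of_nat (2 * k) * ((E - e j) * w ^ j)) +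
      of_nat (2 * k) * ((\<Sum>i<k. e i * w ^ i) - w ^ k)) = of_nat k * (l ^ k - w ^ k)"
  proof -
    have "(\<Sum>j<k. l ^ k + w ^ k - l * w ^ j) =
        of_nat k * l ^ k + of_nat k * w ^ k - l * (\<Sum>j<k. w ^ j)"
      by (simp add: sum.distrib sum_subtractf sum_distrib_left distrib_left)
    moreover have "(\<Sum>j<k. of_nat (2 * k) * ((E - e j) * w ^ j)) =
        l * (\<Sum>j<k. w ^ j) - of_nat (2 * k) * (\<Sum>j<k. e j * w ^ j)"
      by (simp add: l_def left_diff_distrib right_diff_distrib sum_subtractf sum_distrib_left mult.assoc)
    ultimately show ?thesis by (simp add: algebra_simps)
  qed
  finally have "of_nat k * (l ^ k - w ^ k) / of_nat k \<in> ?T"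
    using sums_of_squares_frac_divide[OF R, folded F_def] T(6) by blast
  \<comment> \<open>\<open>l\<close> is a multiple of \<open>of_nat k\<close>, so \<open>k\<close>
    can be cancelled in the field.\<close>
  moreover have "of_nat k \<noteq> (0 :: 'a)" using l0 by (auto simp: l_def)
  ultimately have "l ^ k - w ^ k \<in> ?T" by simp
  \<comment> \<open>The bound on w^k becomes one on \<open>w\<close> through w \<le> 1 + w^k, so
    \<open>1 + l ^ k\<close> is the required element of \<open>R\<close>.\<close>
  moreover have "1 + w ^ k - w ^ 1 \<in> ?T" using k w by (intro sums_of_squares_power_le[OF F]) auto
  ultimately have "(l ^ k - w ^ k) + (1 + w ^ k - w ^ 1) \<in> ?T" by (rule sums_of_squares_add)
  then have "(1 + l ^ k) - w \<in> ?T" by (simp add: algebra_simps)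
  moreover have "1 + l ^ k \<in> R" "1 + l ^ k \<in> ?T"
    using l by (auto intro!: T subdom_add[OF R] subdom_1[OF R] subdom_power[OF R])
  ultimately show ?thesis by (auto simp: F_def)
qed

text \<open>The \<open>c i\<close> are the lower coefficients of the monic polynomial with the sign
  changed. Nothing is assumed about \<open>R\<close> here, so membership is recorded for
  \<open>- c i\<close>, the actual coefficient.\<close>

lemma integral_overE:
  assumes "integral_over R x"
  obtains n c where "x ^ n = (\<Sum>i<n. c i * x ^ i)" "n > 0" "\<And>i. - c i \<in> R"
proof -
  obtain P where P: "lead_coeff P = 1" "\<And>i. Polynomial.coeff P i \<in> R" "poly P x = 0"
    using assms by (auto simp: integral_over_def)
  \<comment> \<open>A monic constant is 1 and has no root.\<close>
  have "degree P > 0"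
  proof (rule ccontr)
    assume "\<not> degree P > 0"
    then obtain a where "P = [:a:]" by (metis degree_eq_zeroE gr0I)
    then show False using P by simp
  qed
  have "0 = (\<Sum>i<degree P. coeff P i * x ^ i) + x ^ degree P"
    using P(1,3) by (simp add: poly_altdef lessThan_Suc_atMost[symmetric])
  then have "x ^ degree P = (\<Sum>i<degree P. (- coeff P i) * x ^ i)"
    by (simp add: sum_negf eq_neg_iff_add_eq_0 add.commute)
  then show ?thesis using that[of "degree P" "\<lambda>i. - coeff P i"] P(2) \<open>degree P > 0\<close> by simp
qed

text \<open>Cauchy-Schwarz turns the integral equation of \<open>b\<close> into the inequality
  (b^2)^n \<le> sum of n c_i^2 (b^2)^i. Its coefficients are sums of squares lying in
  \<open>R\<close>, so the root bound applies to w = b^2.\<close>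

lemma integral_square_bounded:
  assumes R: "subdom R" and real: "real_domain R" and b: "b \<in> frac_field_of R" "integral_over R b"
  shows "\<exists>D \<in> R \<inter> sums_of_squares (frac_field_of R). D - b ^ 2 \<in> sums_of_squares (frac_field_of R)"
proof -
  obtain n c where n: "b ^ n = (\<Sum>i<n. c i * b ^ i)" "n > 0" and c: "\<And>i. - c i \<in> R"
    using b(2) by (rule integral_overE) blast
  let ?F = "frac_field_of R"
  note F = subdom_frac_field_of[OF R]
  have RF: "R \<subseteq> ?F" using subset_frac_field_of subdom_1[OF R] by blast
  have c: "c i \<in> R" for i using subdom_uminus[OF R c[of i]] by simp
  show ?thesis
  proof (rule Cauchy_root_bound[OF R real, of _ n "\<lambda>i. of_nat n * c i ^ 2"])
    show "b\<^sup>2 \<in> sums_of_squares ?F" using b by (intro sums_of_squares_square)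
    show "of_nat n * (c i)\<^sup>2 \<in> R \<inter> sums_of_squares ?F" for i
      using c RF R F by (auto intro!: subdom_mult subdom_of_nat subdom_power sums_of_squares_mult
          sums_of_squares_of_nat sums_of_squares_square)
    have "of_nat n * (\<Sum>i<n. (c i * b ^ i) ^ 2) - (\<Sum>i<n. c i * b ^ i) ^ 2 \<in> sums_of_squares ?F"
      using c RF b by (intro sums_of_squares_Cauchy_Schwarz[OF F] subdom_mult[OF F] subdom_power[OF F]) auto
    moreover have "(\<Sum>i<n. c i * b ^ i) ^ 2 = b\<^sup>2 ^ n" by (simp flip: n(1) power_mult add: mult.commute)
    moreover have "of_nat n * (\<Sum>i<n. (c i * b ^ i) ^ 2) = (\<Sum>i<n. of_nat n * (c i)\<^sup>2 * b\<^sup>2 ^ i)"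
      by (simp add: sum_distrib_left power_mult_distrib mult.assoc flip: power_mult)
        (simp add: mult.commute)
    ultimately show "(\<Sum>i<n. of_nat n * (c i)\<^sup>2 * b\<^sup>2 ^ i) - b\<^sup>2 ^ n \<in> sums_of_squares ?F" by simp
  qed (use n in auto)
qed

section \<open>Integral closure\<close>

definition poly_coeffs_in :: "'k::field set \<Rightarrow> 'k poly set" where
  "poly_coeffs_in R = {P. \<forall>i. coeff P i \<in> R}"

lemma poly_coeffs_in_closed:
  assumes R: "subdom R"
  shows "P \<in> poly_coeffs_in R \<Longrightarrow> Q \<in> poly_coeffs_in R \<Longrightarrow> P + Q \<in> poly_coeffs_in R"
    and "P \<in> poly_coeffs_in R \<Longrightarrow> Q \<in> poly_coeffs_in R \<Longrightarrow> P * Q \<in> poly_coeffs_in R"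
    and "0 \<in> poly_coeffs_in R" "1 \<in> poly_coeffs_in R"
    and "P \<in> poly_coeffs_in R \<Longrightarrow> - P \<in> poly_coeffs_in R"
  by (auto simp: poly_coeffs_in_def coeff_mult coeff_1
      intro!: subdom_add[OF R] subdom_sum[OF R] subdom_mult[OF R] subdom_0[OF R] subdom_1[OF R]
        subdom_uminus[OF R])

lemma poly_coeffs_in_sum:
  assumes R: "subdom R"
  shows "(\<And>i. i \<in> I \<Longrightarrow> f i \<in> poly_coeffs_in R) \<Longrightarrow> sum f I \<in> poly_coeffs_in R"
  by (induction I rule: infinite_finite_induct) (auto intro: poly_coeffs_in_closed[OF R])

lemma poly_coeffs_in_prod:
  assumes R: "subdom R"
  shows "(\<And>i. i \<in> I \<Longrightarrow> f i \<in> poly_coeffs_in R) \<Longrightarrow> prod f I \<in> poly_coeffs_in R"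
  by (induction I rule: infinite_finite_induct) (auto intro: poly_coeffs_in_closed[OF R])

text \<open>The Leibniz formula builds the determinant from signs, products and sums of entries of
  the characteristic matrix, all of which have coefficients in \<open>R\<close>.\<close>

lemma char_poly_coeffs_in:
  assumes R: "subdom R" and A: "A \<in> carrier_mat n n"
    and AR: "\<And>i j. i < n \<Longrightarrow> j < n \<Longrightarrow> A $$ (i, j) \<in> R"
  shows "char_poly A \<in> poly_coeffs_in R"
proof -
  have entry: "char_poly_matrix A $$ (i, j) \<in> poly_coeffs_in R" if ij: "i < n" "j < n" for i j
  proof -
    have "char_poly_matrix A $$ (i, j) = (if i = j then [:0, 1:] else 0) + [:- (A $$ (i, j)):]"
      using A ij by (simp add: char_poly_matrix_def)
    moreover have "[:0, 1:] \<in> poly_coeffs_in R" "[:- (A $$ (i, j)):] \<in> poly_coeffs_in R"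
      using R AR[OF ij]
      by (auto simp: poly_coeffs_in_def coeff_pCons split: nat.split
          intro: subdom_0 subdom_1 subdom_uminus)
    ultimately show ?thesis using poly_coeffs_in_closed[OF R] by auto
  qed
  have "signof p \<in> poly_coeffs_in R" for p :: "nat \<Rightarrow> nat"
    using poly_coeffs_in_closed(4,5)[OF R] by (auto simp: sign_def)
  then show ?thesis
    unfolding char_poly_def det_def'[OF char_poly_matrix_closed[OF A]]
    using entry
    by (intro poly_coeffs_in_sum[OF R] poly_coeffs_in_closed(2)[OF R] poly_coeffs_in_prod[OF R])
      (auto simp: permutes_in_image dest: permutes_in_image[THEN iffD2])
qed

text \<open>The determinant trick: the \<open>v i\<close> form an eigenvector, with eigenvalue
  \<open>z\<close>, of a matrix over \<open>R\<close>, so \<open>z\<close> is a root of its monic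
  characteristic polynomial. A nonzero \<open>v k\<close> is what makes it an eigenvector.\<close>

lemma integral_over_if_stable_module:
  fixes n :: nat
  assumes R: "subdom R" and m: "\<And>i j. i < n \<Longrightarrow> j < n \<Longrightarrow> m i j \<in> R"
    and v: "k < n" "v k \<noteq> 0"
    and z: "\<And>i. i < n \<Longrightarrow> z * v i = (\<Sum>j<n. m i j * v j)"
  shows "integral_over R z"
proof -
  define A where "A = mat n n (\<lambda>(i, j). m i j)"
  have A: "A \<in> carrier_mat n n" by (simp add: A_def)
  have "eigenvector A (vec n v) z"
    unfolding eigenvector_def
  proof (intro conjI)
    show "vec n v \<noteq> 0\<^sub>v (dim_row A)"
    proof
      assume "vec n v = 0\<^sub>v (dim_row A)"
      then have "vec_index (vec n v) k = 0" using v(1) A by simp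
      then show False using v by simp
    qed
    show "A *\<^sub>v vec n v = z \<cdot>\<^sub>v vec n v"
      by (rule eq_vecI) (auto simp: A_def z scalar_prod_def atLeast0LessThan)
  qed (simp add: A_def)
  then have "eigenvalue A z" by (auto simp: eigenvalue_def)
  then have "poly (char_poly A) z = 0" using eigenvalue_root_char_poly[OF A] by blast
  moreover have "char_poly A \<in> poly_coeffs_in R"
    by (rule char_poly_coeffs_in[OF R A]) (auto simp: A_def m)
  ultimately show ?thesis
    unfolding integral_over_def using degree_monic_char_poly[OF A]
    by (intro exI[of _ "char_poly A"]) (auto simp: poly_coeffs_in_def)
qed


lemma integral_over_if_stable_span:
  fixes v :: "nat \<Rightarrow> 'k::field"
  assumes R: "subdom R" and v: "k < n" "v k \<noteq> 0"
    and z: "\<And>i. i < n \<Longrightarrow> z * v i \<in> {\<Sum>j<n. c j * v j | c. range c \<subseteq> R}"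
  shows "integral_over R z"
proof -
  have "\<exists>c. range c \<subseteq> R \<and> z * v i = (\<Sum>j<n. c j * v j)" if "i < n" for i
    using z[OF that] by blast
  then obtain m where m: "range (m i) \<subseteq> R" "z * v i = (\<Sum>j<n. m i j * v j)" if "i < n" for i
    by metis
  show ?thesis
    using m v by (intro integral_over_if_stable_module[of R n m k v z] R) auto
qed

text \<open>For a \<ge> n the equation rewrites x^a as a combination of the powers x^(a-n+i) with i
  < n, all of smaller exponent. The predicate is left general so that the reduction also runs in the
  presence of a further factor.\<close>

lemma power_reduce_induct:
  fixes x :: "'k::field"
  assumes x: "x ^ n = (\<Sum>i<n. c i * x ^ i)"
    and small: "\<And>a. a < n \<Longrightarrow> P (x ^ a)"
    and comb: "\<And>f. (\<And>i. i < n \<Longrightarrow> P (f i)) \<Longrightarrow> P (\<Sum>i<n. c i * f i)"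
  shows "P (x ^ a)"
proof (induction a rule: less_induct)
  case (less a)
  show ?case
  proof (cases "a < n")
    case False
    have "x ^ a = x ^ (a - n) * (\<Sum>i<n. c i * x ^ i)"
      using False by (simp flip: x power_add)
    also have "\<dots> = (\<Sum>i<n. c i * x ^ (a - n + i))"
      by (simp add: sum_distrib_left power_add algebra_simps)
    finally show ?thesis using less False by (auto intro!: comb)
  qed (rule small)
qed

text \<open>The monomials in \<open>x\<close> and \<open>y\<close> span a finitely generated module,
  and \<open>z\<close> is integral as soon as it maps this module into itself. Quantifying over
  every additive group \<open>V\<close> that contains the monomials hides the module from the
  callers.\<close>

lemma integral_over_monomials:
  assumes R: "subdom R" and x: "integral_over R x" and y: "integral_over R y"
    and z: "\<And>V. (\<And>a b. x ^ a * y ^ b \<in> V) \<Longrightarrow> (\<And>u v. u \<in> V \<Longrightarrow> v \<in> V \<Longrightarrow> u + v \<in> V) \<Longrightarrow>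
      (\<And>u. u \<in> V \<Longrightarrow> - u \<in> V) \<Longrightarrow> (\<And>a b. z * (x ^ a * y ^ b) \<in> V)"
  shows "integral_over R z"
proof -
  obtain n c where n: "x ^ n = (\<Sum>i<n. c i * x ^ i)" "n > 0" and c: "\<And>i. - c i \<in> R"
    using x by (rule integral_overE) blast
  obtain m d where m: "y ^ m = (\<Sum>i<m. d i * y ^ i)" "m > 0" and d: "\<And>i. - d i \<in> R"
    using y by (rule integral_overE) blast
  have c: "c i \<in> R" for i using subdom_uminus[OF R c[of i]] by simp
  have d: "d i \<in> R" for i using subdom_uminus[OF R d[of i]] by simp
  \<comment> \<open>Division with remainder by \<open>m\<close> enumerates the exponent pairs below
    (n, m) as one list. The entry at 0 is 1 and provides the nonzero component.\<close>
  define v where "v k = x ^ (k div m) * y ^ (k mod m)" for k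
  define V where "V = {\<Sum>j<n * m. c j * v j | c. range c \<subseteq> R}"
  have V_0: "0 \<in> V" unfolding V_def using subdom_0[OF R] by (intro CollectI exI[of _ "\<lambda>_. 0"]) auto
  have V_add: "u + w \<in> V" if "u \<in> V" "w \<in> V" for u w
  proof -
    obtain f g where fg: "u = (\<Sum>j<n * m. f j * v j)" "w = (\<Sum>j<n * m. g j * v j)"
      "range f \<subseteq> R" "range g \<subseteq> R" using \<open>u \<in> V\<close> \<open>w \<in> V\<close> unfolding V_def by blast
    from fg(1,2) have "u + w = (\<Sum>j<n * m. (f j + g j) * v j)" by (simp add: sum.distrib distrib_right)
    moreover have "range (\<lambda>j. f j + g j) \<subseteq> R" using fg(3,4) by (auto intro!: subdom_add[OF R])
    ultimately show ?thesis
      unfolding V_def by (intro CollectI exI[of _ "\<lambda>j. f j + g j"] conjI)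
  qed
  have V_scale: "r * u \<in> V" if "r \<in> R" "u \<in> V" for r u
  proof -
    obtain f where f: "u = (\<Sum>j<n * m. f j * v j)" "range f \<subseteq> R"
      using \<open>u \<in> V\<close> unfolding V_def by blast
    from f(1) have "r * u = (\<Sum>j<n * m. (r * f j) * v j)" by (simp add: sum_distrib_left mult.assoc)
    moreover have "range (\<lambda>j. r * f j) \<subseteq> R" using f(2) \<open>r \<in> R\<close> by (auto intro!: subdom_mult[OF R])
    ultimately show ?thesis
      unfolding V_def by (intro CollectI exI[of _ "\<lambda>j. r * f j"] conjI)
  qed
  have V_uminus: "- u \<in> V" if "u \<in> V" for u
    using V_scale[OF subdom_uminus[OF R subdom_1[OF R]] that] by simp
  have V_sum: "(\<Sum>i<N. f i * g i) \<in> V" if "\<And>i. f i \<in> R" "\<And>i. i < N \<Longrightarrow> g i \<in> V" for N :: nat and f g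
    using that by (induction N) (auto intro!: V_0 V_add V_scale)
  have V_v: "v k \<in> V" if "k < n * m" for k
    unfolding V_def
  proof (intro CollectI exI conjI)
    show "v k = (\<Sum>j<n * m. (if j = k then 1 else 0) * v j)"
      using that by (simp add: if_distrib[of "\<lambda>c. c * _"] sum.delta cong: if_cong)
    show "range (\<lambda>j. if j = k then 1 else 0) \<subseteq> R" using subdom_0[OF R] subdom_1[OF R] by auto
  qed
  have *: "x ^ a * y ^ b \<in> V" if "a < n" "b < m" for a b
  proof -
    have "a * m + b < n * m"
    proof -
      have "a * m + b < Suc a * m" using that by simp
      also have "\<dots> \<le> n * m" using that by (intro mult_le_mono1) auto
      finally show ?thesis .
    qed
    then show ?thesis using V_v[of "a * m + b"] that by (simp add: v_def)
  qed
  \<comment> \<open>Exponents are lowered one variable at a time: first that of \<open>x\<close>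
    with that of \<open>y\<close> already below \<open>m\<close>, then that of \<open>y\<close> with
    that of \<open>x\<close> arbitrary.\<close>
  have x_pow: "x ^ a * y ^ b \<in> V" if "b < m" for a b
  proof (rule power_reduce_induct[OF n(1), of "\<lambda>u. u * y ^ b \<in> V"])
    fix f :: "nat \<Rightarrow> 'a" assume "\<And>i. i < n \<Longrightarrow> f i * y ^ b \<in> V"
    then have "(\<Sum>i<n. c i * (f i * y ^ b)) \<in> V" using c by (intro V_sum)
    then show "(\<Sum>i<n. c i * f i) * y ^ b \<in> V" by (simp add: sum_distrib_right mult.assoc)
  qed (use that * in blast)
  have mono: "x ^ a * y ^ b \<in> V" for a b
  proof (rule power_reduce_induct[OF m(1), of "\<lambda>u. x ^ a * u \<in> V"])
    fix f :: "nat \<Rightarrow> 'a" assume "\<And>i. i < m \<Longrightarrow> x ^ a * f i \<in> V"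
    then have "(\<Sum>i<m. d i * (x ^ a * f i)) \<in> V" using d by (intro V_sum)
    then show "x ^ a * (\<Sum>i<m. d i * f i) \<in> V" by (simp add: sum_distrib_left mult.left_commute)
  qed (use x_pow in blast)
  show ?thesis
  proof (rule integral_over_if_stable_span[OF R, of 0 "n * m" v])
    show "0 < n * m" using n(2) m(2) by simp
    show "v 0 \<noteq> 0" by (simp add: v_def)
    have "z * (x ^ (i div m) * y ^ (i mod m)) \<in> V" for i
    proof (rule z)
      show "x ^ a * y ^ b \<in> V" for a b by (rule mono)
    qed (fact V_add V_uminus)+
    then show "z * v i \<in> {\<Sum>j<n * m. c j * v j | c. range c \<subseteq> R}" for i
      unfolding V_def v_def .
  qed
qed

lemma integral_over_diff_mult:
  assumes R: "subdom R" and x: "integral_over R x" and y: "integral_over R y"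
  shows "integral_over R (x - y)" "integral_over R (x * y)"
proof -
  show "integral_over R (x - y)"
  proof (rule integral_over_monomials[OF R x y])
    fix V a b assume V: "\<And>a b. x ^ a * y ^ b \<in> V" "\<And>u v. u \<in> V \<Longrightarrow> v \<in> V \<Longrightarrow> u + v \<in> V" "\<And>u. u \<in> V \<Longrightarrow> - u \<in> V"
    have "(x - y) * (x ^ a * y ^ b) = x ^ Suc a * y ^ b + - (x ^ a * y ^ Suc b)"
      by (simp add: algebra_simps)
    then show "(x - y) * (x ^ a * y ^ b) \<in> V"
      using V(2)[OF V(1)[of "Suc a" b] V(3)[OF V(1)[of a "Suc b"]]] by simp
  qed
  show "integral_over R (x * y)"
  proof (rule integral_over_monomials[OF R x y])
    fix V a b assume V: "\<And>a b. x ^ a * y ^ b \<in> V"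
    have "(x * y) * (x ^ a * y ^ b) = x ^ Suc a * y ^ Suc b" by (simp add: algebra_simps)
    then show "(x * y) * (x ^ a * y ^ b) \<in> V" using V[of "Suc a" "Suc b"] by (simp add: ac_simps)
  qed
qed

lemma integral_over_mem: assumes R: "subdom R" and x: "x \<in> R" shows "integral_over R x"
  unfolding integral_over_def
  by (intro exI[of _ "[:- x, 1:]"])
    (use assms in \<open>auto simp: coeff_pCons split: nat.split intro: subdom_0 subdom_1 subdom_uminus\<close>)

lemma subdom_integral_closure_in:
  assumes R: "subdom R" and S: "subdom S" and "R \<subseteq> S"
  shows "subdom (integral_closure_in R S)" "R \<subseteq> integral_closure_in R S"
proof -
  show "R \<subseteq> integral_closure_in R S"
    using integral_over_mem[OF R] \<open>R \<subseteq> S\<close> by (auto simp: integral_closure_in_def)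
  show "subdom (integral_closure_in R S)"
    by (rule subdomI) (auto simp: integral_closure_in_def intro: integral_over_diff_mult[OF R]
        subdom_1[OF S] subdom_diff[OF S] subdom_mult[OF S] integral_over_mem[OF R subdom_1[OF R]])
qed

hide_const (open) Ring_Hom.ring_hom

section \<open>Residue fields\<close>

lemma a_r_coset_ring_on: "m +>\<^bsub>ring_on A\<^esub> a = {h + a | h. h \<in> m}"
  by (auto simp: a_r_coset_def')

lemma a_r_coset_ring_on_eq_iff:
  assumes A: "subdom A" and m: "ideal m (ring_on A)"
  shows "m +>\<^bsub>ring_on A\<^esub> a = m +>\<^bsub>ring_on A\<^esub> b \<longleftrightarrow> a - b \<in> m"
proof
  assume "m +>\<^bsub>ring_on A\<^esub> a = m +>\<^bsub>ring_on A\<^esub> b"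
  moreover have "0 + a \<in> m +>\<^bsub>ring_on A\<^esub> a"
    unfolding a_r_coset_ring_on using idealD(2)[OF A m] by blast
  ultimately obtain h where "h \<in> m" "0 + a = h + b" by (auto simp: a_r_coset_ring_on)
  then show "a - b \<in> m" by simp
next
  assume ab: "a - b \<in> m"
  have "h + a = (h + (a - b)) + b" "h + b = (h - (a - b)) + a" for h by simp_all
  then show "m +>\<^bsub>ring_on A\<^esub> a = m +>\<^bsub>ring_on A\<^esub> b"
    unfolding a_r_coset_ring_on using idealD(3,7)[OF A m _ ab] by blast
qed

text \<open>As \<open>m\<close> is the trace of \<open>n\<close> on \<open>A\<close>, the map of
  quotients is always a well-defined injective homomorphism. Being an isomorphism thus amounts to
  surjectivity, that is, to A + n = B.\<close>

lemma Quot_map_iso_iff: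
  fixes A B m n :: "'k::field set"
  assumes A: "subdom A" and B: "subdom B" and AB: "A \<subseteq> B"
    and m: "ideal m (ring_on A)" and n: "ideal n (ring_on B)" and mn: "m = n \<inter> A"
  shows "(\<lambda>Z. n <+>\<^bsub>ring_on B\<^esub> Z) \<in> ring_iso (ring_on A Quot m) (ring_on B Quot n) \<longleftrightarrow>
    (\<forall>b\<in>B. \<exists>a\<in>A. b - a \<in> n)"
proof -
  let ?f = "\<lambda>Z. n <+>\<^bsub>ring_on B\<^esub> Z"
  interpret m: ideal m "ring_on A" by (rule m)
  interpret n: ideal n "ring_on B" by (rule n)
  \<comment> \<open>The coset of \<open>a\<close> modulo \<open>m\<close> goes to the coset of
    \<open>a\<close> modulo \<open>n\<close>, since adding elements of
    \<open>m \<subseteq> n\<close> does not enlarge \<open>n\<close>.\<close>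
  have f: "?f (m +>\<^bsub>ring_on A\<^esub> a) = n +>\<^bsub>ring_on B\<^esub> a" for a
  proof -
    have "?f (m +>\<^bsub>ring_on A\<^esub> a) = {h + (h' + a) | h h'. h \<in> n \<and> h' \<in> m}"
      by (auto simp: set_add_def' a_r_coset_ring_on)
    also have "\<dots> = {h + a | h. h \<in> n}"
    proof (intro equalityI subsetI)
      fix x assume "x \<in> {h + (h' + a) | h h'. h \<in> n \<and> h' \<in> m}"
      then obtain h h' where h: "x = h + (h' + a)" "h \<in> n" "h' \<in> n" using mn by blast
      then have "h + h' \<in> n" using idealD(3)[OF B n] by blast
      moreover have "x = (h + h') + a" using h by simp
      ultimately show "x \<in> {h + a | h. h \<in> n}" by blast
    next
      fix x assume "x \<in> {h + a | h. h \<in> n}"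
      then obtain h where "x = h + (0 + a)" "h \<in> n" by auto
      then show "x \<in> {h + (h' + a) | h h'. h \<in> n \<and> h' \<in> m}" using idealD(2)[OF A m] by blast
    qed
    finally show ?thesis by (simp add: a_r_coset_ring_on)
  qed
  have cA: "carrier (ring_on A Quot m) = (\<lambda>a. m +>\<^bsub>ring_on A\<^esub> a) ` A"
    and cB: "carrier (ring_on B Quot n) = (\<lambda>b. n +>\<^bsub>ring_on B\<^esub> b) ` B"
    by (auto simp: FactRing_def A_RCOSETS_def')
  have "?f \<in> ring_hom (ring_on A Quot m) (ring_on B Quot n)"
  proof (rule ring_hom_memI)
    fix U assume "U \<in> carrier (ring_on A Quot m)"
    then obtain a where a: "a \<in> A" "U = m +>\<^bsub>ring_on A\<^esub> a" unfolding cA by blast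
    show "?f U \<in> carrier (ring_on B Quot n)" unfolding cB a f using a AB by blast
    fix W assume "W \<in> carrier (ring_on A Quot m)"
    then obtain b where b: "b \<in> A" "W = m +>\<^bsub>ring_on A\<^esub> b" unfolding cA by blast
    have ab: "a \<in> B" "b \<in> B" using a b AB by auto
    show "?f (U \<otimes>\<^bsub>ring_on A Quot m\<^esub> W) = ?f U \<otimes>\<^bsub>ring_on B Quot n\<^esub> ?f W"
      using m.rcoset_mult_add[of a b] n.rcoset_mult_add[of a b] a b ab by (simp add: FactRing_def f)
    show "?f (U \<oplus>\<^bsub>ring_on A Quot m\<^esub> W) = ?f U \<oplus>\<^bsub>ring_on B Quot n\<^esub> ?f W"
      using m.a_rcos_sum[of a b] n.a_rcos_sum[of a b] a b ab by (simp add: FactRing_def f)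
  next
    show "?f \<one>\<^bsub>ring_on A Quot m\<^esub> = \<one>\<^bsub>ring_on B Quot n\<^esub>"
      by (simp add: FactRing_def f)
  qed
  moreover have "inj_on ?f (carrier (ring_on A Quot m))"
  proof (rule inj_onI)
    fix U W assume "U \<in> carrier (ring_on A Quot m)" "W \<in> carrier (ring_on A Quot m)" and eq: "?f U = ?f W"
    then obtain a b where ab: "a \<in> A" "b \<in> A" "U = m +>\<^bsub>ring_on A\<^esub> a" "W = m +>\<^bsub>ring_on A\<^esub> b"
      unfolding cA by blast
    have "n +>\<^bsub>ring_on B\<^esub> a = n +>\<^bsub>ring_on B\<^esub> b" using eq unfolding ab f .
    then have "a - b \<in> n" using a_r_coset_ring_on_eq_iff[OF B n] by blast
    then have "a - b \<in> m" using mn ab subdom_diff[OF A] by blast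
    then show "U = W" unfolding ab using a_r_coset_ring_on_eq_iff[OF A m] by blast
  qed
  moreover have "?f ` carrier (ring_on A Quot m) = carrier (ring_on B Quot n) \<longleftrightarrow>
      (\<forall>b\<in>B. \<exists>a\<in>A. b - a \<in> n)"
  proof -
    have "?f ` carrier (ring_on A Quot m) = (\<lambda>a. n +>\<^bsub>ring_on B\<^esub> a) ` A"
      unfolding cA image_image f ..
    also have "\<dots> = (\<lambda>b. n +>\<^bsub>ring_on B\<^esub> b) ` B \<longleftrightarrow>
        (\<forall>b\<in>B. \<exists>a\<in>A. n +>\<^bsub>ring_on B\<^esub> b = n +>\<^bsub>ring_on B\<^esub> a)"
    proof (intro iffI equalityI)
      assume "(\<lambda>a. n +>\<^bsub>ring_on B\<^esub> a) ` A = (\<lambda>b. n +>\<^bsub>ring_on B\<^esub> b) ` B"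
      then show "\<forall>b\<in>B. \<exists>a\<in>A. n +>\<^bsub>ring_on B\<^esub> b = n +>\<^bsub>ring_on B\<^esub> a" by blast
    next
      show "(\<lambda>a. n +>\<^bsub>ring_on B\<^esub> a) ` A \<subseteq> (\<lambda>b. n +>\<^bsub>ring_on B\<^esub> b) ` B"
        using AB by (rule image_mono)
      assume "\<forall>b\<in>B. \<exists>a\<in>A. n +>\<^bsub>ring_on B\<^esub> b = n +>\<^bsub>ring_on B\<^esub> a"
      then show "(\<lambda>b. n +>\<^bsub>ring_on B\<^esub> b) ` B \<subseteq> (\<lambda>a. n +>\<^bsub>ring_on B\<^esub> a) ` A" by auto
    qed
    also have "\<dots> \<longleftrightarrow> (\<forall>b\<in>B. \<exists>a\<in>A. b - a \<in> n)"
      unfolding a_r_coset_ring_on_eq_iff[OF B n] ..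
    finally show ?thesis unfolding cB .
  qed
  ultimately show ?thesis by (auto simp: ring_iso_def bij_betw_def)
qed

text \<open>Surjectivity on residue fields with denominators cleared: each element of
  \<open>S\<close> agrees modulo \<open>q\<close> with a fraction a/s over \<open>R\<close>. This
  form is what connects equiresiduality with the gluing.\<close>

lemma residue_map_iso_iff:
  fixes R S q :: "'k::field set"
  assumes R: "subdom R" and S: "subdom S" and RS: "R \<subseteq> S" and q: "primeideal q (ring_on S)"
  shows "residue_map S q \<in> ring_iso (residue_field R (q \<inter> R)) (residue_field S q) \<longleftrightarrow>
    (\<forall>b\<in>S. \<exists>a\<in>R. \<exists>s\<in>R - q. s * b - a \<in> q)"
proof -
  define p where "p = q \<inter> R"
  have p: "primeideal p (ring_on R)" unfolding p_def by (rule primeideal_contract[OF R S RS q])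
  let ?A = "loc R p R" and ?B = "loc S q S" and ?m = "loc R p p" and ?n = "loc S q q"
  note Q = primeidealD[OF S q]
  note I = idealD[OF S Q(1)]
  have A: "subdom ?A" by (rule subdom_loc[OF R R order_refl p])
  have B: "subdom ?B" by (rule subdom_loc[OF S S order_refl q])
  have AB: "?A \<subseteq> ?B" using RS by (auto simp: loc_def p_def)
  have m: "ideal ?m (ring_on ?A)" by (rule ideal_loc[OF R R order_refl p primeidealD(1)[OF R p]])
  have n: "ideal ?n (ring_on ?B)" by (rule ideal_loc[OF S S order_refl q Q(1)])
  have S_n: "x \<in> q" if "x \<in> S" "x \<in> ?n" for x
    by (rule loc_prime_mem[OF S S order_refl q q _ that]) auto
  have SB: "S \<subseteq> ?B" by (rule subset_loc[OF S q])
  have mn: "?m = ?n \<inter> ?A"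
  proof
    have "?m \<subseteq> ?n" using RS by (auto simp: loc_def p_def)
    moreover have "?m \<subseteq> ?A" by (auto simp: loc_def p_def)
    ultimately show "?m \<subseteq> ?n \<inter> ?A" by blast
    show "?n \<inter> ?A \<subseteq> ?m"
    proof
      fix x assume x: "x \<in> ?n \<inter> ?A"
      then obtain a s where as: "a \<in> R" "s \<in> R" "s \<notin> p" "x = a / s" by (auto elim: locE)
      then have "s \<in> S" "s \<noteq> 0" using RS primeidealD(6)[OF R p, of s] by auto
      then have "s * x \<in> ?n" using idealD(4)[OF B n, of s x] SB x by blast
      then have "a \<in> ?n" using as \<open>s \<noteq> 0\<close> by simp
      then have "a \<in> p" using S_n[of a] as RS by (auto simp: p_def)
      then show "x \<in> ?m" using as by (auto intro: locI)
    qed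
  qed
  have "(\<forall>b\<in>?B. \<exists>a\<in>?A. b - a \<in> ?n) \<longleftrightarrow> (\<forall>b\<in>S. \<exists>a\<in>R. \<exists>s\<in>R - q. s * b - a \<in> q)" (is "?L \<longleftrightarrow> ?R")
  proof
    assume L: ?L
    show ?R
    proof
      fix b assume b: "b \<in> S"
      then obtain x where x: "x \<in> ?A" "b - x \<in> ?n" using L SB by blast
      then obtain a s where as: "a \<in> R" "s \<in> R" "s \<notin> p" "x = a / s" by (auto elim: locE)
      then have s: "s \<in> S" "a \<in> S" "s \<noteq> 0" "s \<in> R - q" using RS primeidealD(6)[OF R p, of s] by (auto simp: p_def)
      then have "s * (b - x) \<in> ?n" using idealD(4)[OF B n, of s] SB x by blast
      moreover have "s * (b - x) = s * b - a" using as s by (simp add: algebra_simps)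
      moreover have "s * b - a \<in> S" using s b S by (intro subdom_diff subdom_mult)
      ultimately have "s * b - a \<in> q" using S_n by simp
      then show "\<exists>a\<in>R. \<exists>s\<in>R - q. s * b - a \<in> q" using as s by blast
    qed
  next
    assume r: ?R
    show ?L
    proof
      fix x assume "x \<in> ?B"
      then obtain b t where bt: "b \<in> S" "t \<in> S" "t \<notin> q" "x = b / t" by (auto elim: locE)
      \<comment> \<open>For x = b/t approximate numerator and denominator separately, b by a/s and t
        by c/u. Then x is approximated by ua/(sc), where \<open>c \<notin> q\<close> because neither
        \<open>u\<close> nor \<open>t\<close> lies in \<open>q\<close>.\<close>
      obtain a s where as: "a \<in> R" "s \<in> R - q" "s * b - a \<in> q" using r bt by blast
      obtain c u where cu: "c \<in> R" "u \<in> R - q" "u * t - c \<in> q" using r bt by blast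
      have "s \<in> S - q" "u \<in> S - q" "t \<in> S - q" using as cu bt RS by auto
      have "c \<notin> q"
      proof
        assume "c \<in> q"
        then have "u * t \<in> q" using I(3)[OF cu(3), of c] by simp
        then show False using Q(5)[OF \<open>u \<in> S - q\<close> \<open>t \<in> S - q\<close>] by blast
      qed
      then have "c \<in> S - q" using cu RS by auto
      have nz: "s \<noteq> 0" "u \<noteq> 0" "t \<noteq> 0" "c \<noteq> 0"
        using Q(6) \<open>s \<in> S - q\<close> \<open>u \<in> S - q\<close> \<open>t \<in> S - q\<close> \<open>c \<in> S - q\<close> by blast+
      have "x - (u * a) / (s * c) = (c * (s * b - a) - a * (u * t - c)) / (t * (s * c))"
        using nz bt by (simp add: field_simps)
      moreover have "c * (s * b - a) - a * (u * t - c) \<in> q"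
        using I(7)[OF I(4)[of c "s * b - a"] I(4)[of a "u * t - c"]] as(1,3) cu(1,3) RS by auto
      moreover have "t * (s * c) \<in> S - q"
        by (intro Q(5)) fact+
      ultimately have "x - (u * a) / (s * c) \<in> ?n" using locI[of _ q "t * (s * c)" S q] by auto
      moreover have "(u * a) / (s * c) \<in> ?A"
      proof (rule locI)
        show "u * a \<in> R" "s * c \<in> R" using as cu R by (auto intro: subdom_mult)
        show "s * c \<notin> p" using Q(5)[OF \<open>s \<in> S - q\<close> \<open>c \<in> S - q\<close>] by (auto simp: p_def)
      qed
      ultimately show "\<exists>a\<in>?A. x - a \<in> ?n" by blast
    qed
  qed
  moreover have "residue_map S q = (\<lambda>Z. ?n <+>\<^bsub>ring_on ?B\<^esub> Z)" by (auto simp: residue_map_def)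
  ultimately show ?thesis
    using Quot_map_iso_iff[OF A B AB m n mn] by (simp add: residue_field_def p_def)
qed

section \<open>Central primes\<close>

lemma C_SpecI: "primeideal p (ring_on R) \<Longrightarrow> central R p \<Longrightarrow> p \<in> C_Spec R"
  by (simp add: C_Spec_def)

lemma C_SpecD: "p \<in> C_Spec R \<Longrightarrow> primeideal p (ring_on R)" "p \<in> C_Spec R \<Longrightarrow> central R p"
  by (simp_all add: C_Spec_def)

lemma centralD:
  "central R I \<Longrightarrow> a \<in> R \<Longrightarrow> b \<in> sums_of_squares (frac_field_of R) \<Longrightarrow> a ^ 2 + b \<in> I \<Longrightarrow> a \<in> I"
  by (auto simp: central_def)

text \<open>If \<open>- 1\<close> is a sum of squares, then 0 = 1^2 + (-1) forces 1 into every
  central ideal.\<close>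

lemma C_Spec_empty_if_not_real:
  assumes R: "subdom R" and "\<not> real_domain R" shows "C_Spec R = {}"
proof -
  have False if p: "p \<in> C_Spec R" for p
  proof -
    note P = primeidealD[OF R C_SpecD(1)[OF p]]
    have "1\<^sup>2 + (- 1) \<in> p" using idealD(2)[OF R P(1)] by simp
    then have "1 \<in> p"
      using centralD[OF C_SpecD(2)[OF p] subdom_1[OF R]] assms(2) unfolding real_domain_def by blast
    then show False using P(2) by blast
  qed
  then show ?thesis by blast
qed

lemma real_domain_antimono: "R \<subseteq> S \<Longrightarrow> real_domain S \<Longrightarrow> real_domain R"
  using sums_of_squares_mono[OF frac_field_of_mono] unfolding real_domain_def by blast

lemma primeideal_zero:
  assumes R: "subdom R" shows "primeideal {0} (ring_on R)"
  unfolding primeideal_ring_on_iff[OF R] ideal_ring_on_iff[OF R] using subdom_0[OF R] by auto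

text \<open>A relation a^2 + b = 0 with nonzero \<open>a\<close> would give -1 = b/a^2, a sum of
  squares.\<close>

lemma zero_in_C_Spec:
  assumes R: "subdom R" and real: "real_domain R" shows "{0} \<in> C_Spec R"
proof -
  let ?F = "frac_field_of R"
  note F = subdom_frac_field_of[OF R]
  have "a = 0" if a: "a \<in> R" and b: "b \<in> sums_of_squares ?F" and ab: "a\<^sup>2 + b = 0" for a b
  proof (rule ccontr)
    assume "a \<noteq> 0"
    have "a\<^sup>2 \<in> sums_of_squares ?F"
      using a subset_frac_field_of[OF subdom_1[OF R]] by (intro sums_of_squares_square) auto
    then have "b / a\<^sup>2 \<in> sums_of_squares ?F" by (rule sums_of_squares_frac_divide[OF R b])
    moreover have "b = - (a\<^sup>2)" using ab by (simp add: eq_neg_iff_add_eq_0 add.commute)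
    then have "b / a\<^sup>2 = - 1" using \<open>a \<noteq> 0\<close> by simp
    ultimately show False using real by (simp add: real_domain_def)
  qed
  then show ?thesis
    using primeideal_zero[OF R] primeidealD(1)[OF R primeideal_zero[OF R]]
    by (auto intro!: C_SpecI simp: central_def)
qed

text \<open>Modulo \<open>q\<close>, \<open>b\<close> divides the constant term of any monic
  equation it satisfies over \<open>R\<close>. If that equation has least degree modulo
  \<open>q\<close>, its constant term is nonzero there.\<close>

lemma integral_prime_divides:
  assumes R: "subdom R" and S: "subdom S" and RS: "R \<subseteq> S" and int: "integral_over R b"
    and q: "primeideal q (ring_on S)" and b: "b \<in> S" "b \<notin> q"
  shows "\<exists>c\<in>S. \<exists>d\<in>q. b * c + d \<in> R - q"
proof -
  note Q = primeidealD[OF S q] note I = idealD[OF S Q(1)]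
  let ?P = "\<lambda>n. \<exists>c. range c \<subseteq> R \<and> b ^ n + (\<Sum>i<n. c i * b ^ i) \<in> q"
  have ex: "\<exists>n. ?P n"
  proof -
    obtain n c where "b ^ n = (\<Sum>i<n. c i * b ^ i)" and c: "\<And>i. - c i \<in> R"
      using int by (rule integral_overE) blast
    then have "b ^ n + (\<Sum>i<n. (- c i) * b ^ i) = 0" by (simp add: sum_negf)
    then have "b ^ n + (\<Sum>i<n. (- c i) * b ^ i) \<in> q" using I(2) by simp
    moreover have "range (\<lambda>i. - c i) \<subseteq> R" using c by auto
    ultimately show ?thesis by (intro exI[of _ n] exI[of _ "\<lambda>i. - c i"] conjI)
  qed
  define n where "n = (LEAST n. ?P n)"
  have "?P n" unfolding n_def by (rule LeastI_ex[OF ex])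
  then obtain c where c: "range c \<subseteq> R" "b ^ n + (\<Sum>i<n. c i * b ^ i) \<in> q" by blast
  have "n \<noteq> 0" using c(2) Q(2) by (intro notI) simp
  then obtain k where k: "n = Suc k" using not0_implies_Suc by blast
  \<comment> \<open>\<open>e\<close> is the cofactor: the relation reads b e + c_0 modulo
    \<open>q\<close>. It is itself a monic expression of degree one less, so minimality keeps it out
    of \<open>q\<close>, and then \<open>c 0\<close> is outside as well.\<close>
  define e where "e = b ^ k + (\<Sum>i<k. c (Suc i) * b ^ i)"
  have cR: "c i \<in> R" for i using c(1) by blast
  have e: "e \<in> S" unfolding e_def
    using b cR RS by (intro subdom_add[OF S] subdom_power[OF S] subdom_sum[OF S] subdom_mult[OF S]) auto
  have eq: "b ^ n + (\<Sum>i<n. c i * b ^ i) = b * e + c 0"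
    by (simp add: e_def k sum.lessThan_Suc_shift sum_distrib_left algebra_simps del: sum.lessThan_Suc)
  have "e \<notin> q"
  proof
    assume "e \<in> q"
    then have "?P k" unfolding e_def using cR by (intro exI[of _ "\<lambda>i. c (Suc i)"]) auto
    then have "n \<le> k" unfolding n_def by (rule Least_le)
    then show False using k by simp
  qed
  have "c 0 \<notin> q"
  proof
    assume "c 0 \<in> q"
    then have "b * e + c 0 - c 0 \<in> q" using I(7)[of "b * e + c 0" "c 0"] c(2) eq by simp
    then show False using Q(3)[OF b(1) e] b(2) \<open>e \<notin> q\<close> by simp
  qed
  have "b * (- e) + (b * e + c 0) = c 0" by simp
  then show ?thesis
    using cR[of 0] \<open>c 0 \<notin> q\<close> c(2) eq subdom_uminus[OF S e] by (metis DiffI)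
qed

text \<open>By the divisibility lemma for the prime \<open>{0}\<close>, a nonzero element of
  \<open>q\<close> has a nonzero multiple in \<open>R\<close>, which would lie in
  \<open>q \<inter> R\<close>.\<close>

lemma zero_ideal_lies_over_zero:
  assumes R: "subdom R" and S: "subdom S" and RS: "R \<subseteq> S" and int: "\<And>x. x \<in> S \<Longrightarrow> integral_over R x"
    and q: "primeideal q (ring_on S)" "q \<inter> R = {0}"
  shows "q = {0}"
proof -
  note I = idealD[OF S primeidealD(1)[OF S q(1)]]
  have "b = 0" if b: "b \<in> q" for b
  proof (rule ccontr)
    assume "b \<noteq> 0"
    then obtain c where c: "c \<in> S" "b * c \<in> R - {0}"
      using integral_prime_divides[OF R S RS int primeideal_zero[OF S], of b] b I(1) by auto
    then have "b * c \<in> q" using I(5)[OF b] by blast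
    then show False using c q(2) by blast
  qed
  then show ?thesis using I(2) by blast
qed

section \<open>Maximal and central ideals of the localization at a prime\<close>

context
  fixes R S p :: "'k::field set"
  assumes R: "subdom R" and S: "subdom S" and RS: "R \<subseteq> S" and p: "primeideal p (ring_on R)"
begin

lemma frac_field_of_loc: "frac_field_of (loc R p S) = frac_field_of S"
proof (rule frac_field_of_eq[OF S subset_loc[OF R p]])
  show "loc R p S \<subseteq> frac_field_of S"
  proof
    fix x assume "x \<in> loc R p S"
    then obtain a s where as: "a \<in> S" "s \<in> R" "s \<notin> p" "x = a / s" by (rule locE)
    then show "x \<in> frac_field_of S"
      using primeidealD(6)[OF R p, of s] RS by (auto intro!: frac_field_ofI)
  qed
qed

lemma central_loc:
  assumes q: "primeideal q (ring_on S)" "central S q" and qp: "q \<inter> R \<subseteq> p"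
  shows "central (loc R p S) (loc R p q)"
  unfolding central_def frac_field_of_loc
proof (intro conjI ballI impI)
  note Q = primeidealD[OF S q(1)] note F = subdom_frac_field_of[OF S]
  have L: "subdom (loc R p S)" by (rule subdom_loc[OF R S RS p])
  show J: "ideal (loc R p q) (ring_on (loc R p S))" by (rule ideal_loc[OF R S RS p Q(1)])
  fix x t assume x: "x \<in> loc R p S" and t: "t \<in> sums_of_squares (frac_field_of S)"
    and xt: "x\<^sup>2 + t \<in> loc R p q"
  obtain b s where bs: "b \<in> S" "s \<in> R" "s \<notin> p" "x = b / s" using x by (rule locE)
  obtain m u where mu: "m \<in> q" "u \<in> R" "u \<notin> p" "x\<^sup>2 + t = m / u" using xt by (rule locE)
  have nz: "s \<noteq> 0" "u \<noteq> 0" using primeidealD(6)[OF R p] bs mu by auto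
  have su: "s \<in> S" "u \<in> S" using bs mu RS by auto
  have "b = s * x" using bs nz by simp
  \<comment> \<open>The factor that clears denominators is the square of s u, so that t (s u)^2 is
    still a sum of squares.\<close>
  then have "(b * u)\<^sup>2 + t * (s * u)\<^sup>2 = (s * u)\<^sup>2 * (x\<^sup>2 + t)"
    by (simp add: power2_eq_square algebra_simps)
  also have "\<dots> = (s\<^sup>2 * u) * m" unfolding mu(4) using nz by (simp add: power2_eq_square)
  also have "\<dots> \<in> q" using su mu by (intro idealD(4)[OF S Q(1)] subdom_mult[OF S] subdom_power[OF S])
  finally have "(b * u)\<^sup>2 + t * (s * u)\<^sup>2 \<in> q" .
  moreover have "t * (s * u)\<^sup>2 \<in> sums_of_squares (frac_field_of S)"
    using t su subset_frac_field_of[OF subdom_1[OF S]] subdom_mult[OF S]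
    by (intro sums_of_squares_mult[OF F] sums_of_squares_square) auto
  moreover have "b * u \<in> S" using bs su subdom_mult[OF S] by blast
  ultimately have "b * u \<in> q" using centralD[OF q(2)] by blast
  then have "b \<in> q" using Q(3)[OF bs(1) su(2)] mu qp by blast
  then show "x \<in> loc R p q" using bs by (auto intro: locI)
qed

text \<open>For x = b/s outside the ideal, \<open>b\<close> divides some u in R - p modulo
  \<open>q\<close> by integrality. As \<open>u\<close> is a unit of the localization,
  \<open>x\<close> is invertible modulo the ideal.\<close>

lemma maximalideal_loc:
  assumes int: "\<And>x. x \<in> S \<Longrightarrow> integral_over R x"
    and q: "primeideal q (ring_on S)" and qp: "q \<inter> R = p"
  shows "maximalideal (loc R p q) (ring_on (loc R p S))"
  unfolding maximalideal_ring_on_iff[OF subdom_loc[OF R S RS p]]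
proof (intro conjI ballI)
  have "primeideal (loc R p q) (ring_on (loc R p S))"
    by (rule primeideal_loc[OF R S RS p q]) (simp add: qp)
  note P = primeidealD[OF subdom_loc[OF R S RS p] this]
  show "ideal (loc R p q) (ring_on (loc R p S))" "1 \<notin> loc R p q" by (rule P)+
  fix x assume x: "x \<in> loc R p S - loc R p q"
  then obtain b s where bs: "b \<in> S" "s \<in> R" "s \<notin> p" "x = b / s" by (auto elim: locE)
  then have "b \<notin> q" using x by (auto intro: locI)
  then obtain c d where cd: "c \<in> S" "d \<in> q" "b * c + d \<in> R - q"
    using integral_prime_divides[OF R S RS int[OF bs(1)] q bs(1)] by blast
  define u where "u = b * c + d"
  have u: "u \<in> R" "u \<notin> p" using cd qp by (auto simp: u_def)
  have nz: "s \<noteq> 0" "u \<noteq> 0" using primeidealD(6)[OF R p] bs u by auto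
  show "\<exists>y\<in>loc R p S. \<exists>z\<in>loc R p q. x * y + z = 1"
  proof (intro bexI)
    show "x * (s * c / u) + d / u = 1" using nz by (simp add: bs(4) u_def flip: add_divide_distrib)
    show "d / u \<in> loc R p q" using cd u by (auto intro: locI)
    show "s * c / u \<in> loc R p S" using bs cd u RS by (auto intro!: locI subdom_mult[OF S])
  qed
qed

text \<open>Elements of R - p are units, so M \<inter> R \<subseteq> p. If some \<open>x\<close> in
  \<open>p\<close> were outside \<open>M\<close>, it would be invertible modulo \<open>M\<close> by
  a fraction b/s, and the integral equation of \<open>b\<close> would put a power of
  \<open>s\<close> into \<open>p\<close>.\<close>

lemma maximalideal_loc_contract:
  assumes int: "\<And>x. x \<in> S \<Longrightarrow> integral_over R x"
    and M: "maximalideal M (ring_on (loc R p S))"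
  shows "M \<inter> R = p"
proof -
  have L: "subdom (loc R p S)" by (rule subdom_loc[OF R S RS p])
  have SL: "S \<subseteq> loc R p S" by (rule subset_loc[OF R p])
  have M': "primeideal M (ring_on (loc R p S))" by (rule maximalideal_imp_primeideal[OF L M])
  note P = primeidealD[OF L M'] note I = idealD[OF L P(1)]
  have sub: "M \<inter> R \<subseteq> p"
  proof
    fix x assume x: "x \<in> M \<inter> R"
    show "x \<in> p"
    proof (rule ccontr)
      assume "x \<notin> p"
      then have "1 / x \<in> loc R p S" "x \<noteq> 0"
        using x subdom_1[OF S] primeidealD(6)[OF R p, of x] by (auto intro: locI)
      then have "1 \<in> M" using I(5)[of x "1 / x"] x by simp
      then show False using P(2) by blast
    qed
  qed
  moreover have "x \<in> M" if x: "x \<in> p" for x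
  proof (rule ccontr)
    assume "x \<notin> M"
    note J = idealD[OF R primeidealD(1)[OF R p]]
    have xR: "x \<in> R" using J(1) x by blast
    then have "x \<in> loc R p S - M" using \<open>x \<notin> M\<close> RS SL by blast
    then obtain y z where yz: "y \<in> loc R p S" "z \<in> M" "x * y + z = 1"
      using M unfolding maximalideal_ring_on_iff[OF L] by blast
    obtain b s where bs: "b \<in> S" "s \<in> R" "s \<notin> p" "y = b / s" using yz(1) by (rule locE)
    obtain n c where n: "b ^ n = (\<Sum>i<n. c i * b ^ i)" "n > 0" and c: "\<And>i. - c i \<in> R"
      using int[OF bs(1)] by (rule integral_overE) blast
    have c: "c i \<in> R" for i using subdom_uminus[OF R c[of i]] by simp
    have s: "s \<noteq> 0" "s \<in> loc R p S" using bs primeidealD(6)[OF R p, of s] RS SL by auto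
    define w where "w = x * b"
    have w: "w \<in> loc R p S" unfolding w_def using xR bs RS SL subdom_mult[OF S] by blast
    have "s - w = s * z"
      using yz(3) bs(4) s by (simp add: w_def field_simps)
    then have "s - w \<in> M" using I(4)[OF s(2) yz(2)] by simp
    \<comment> \<open>Multiplying the equation of \<open>b\<close> by x^n gives w^n = e(w) for w = x
      b. Since \<open>w\<close> is congruent to \<open>s\<close> modulo \<open>M\<close>, also s^n -
      e(s) lies in \<open>M\<close>, now with both terms in \<open>R\<close>. Each term of e(s)
      carries a factor \<open>x\<close>, so e(s) and then s^n lie in \<open>p\<close>.\<close>
    define e where "e k = (\<Sum>i<n. c i * x ^ (n - i) * k ^ i)" for k
    have "w ^ n = x ^ n * (\<Sum>i<n. c i * b ^ i)" by (simp add: w_def power_mult_distrib n(1))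
    also have "\<dots> = e w"
      unfolding e_def sum_distrib_left
      by (intro sum.cong) (auto simp: w_def power_mult_distrib algebra_simps simp flip: power_add)
    finally have "w ^ n = e w" .
    have diff: "s ^ k - w ^ k \<in> M" for k
    proof (induction k)
      case (Suc k)
      have "s ^ Suc k - w ^ Suc k = s * (s ^ k - w ^ k) + (s - w) * w ^ k" by (simp add: algebra_simps)
      then show ?case
        using I(3)[OF I(4)[OF s(2) Suc] I(5)[OF \<open>s - w \<in> M\<close> subdom_power[OF L w, of k]]] by simp
    qed (simp add: I(2))
    have "e s - e w = (\<Sum>i<n. c i * x ^ (n - i) * (s ^ i - w ^ i))"
      by (simp add: e_def sum_subtractf algebra_simps)
    also have "\<dots> \<in> M"
    proof -
      have "c i * x ^ (n - i) * (s ^ i - w ^ i) \<in> M" for i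
        by (rule I(4)[OF _ diff]) (use c xR RS SL subdom_mult[OF R] subdom_power[OF R] in blast)
      then have "(\<Sum>i<k. c i * x ^ (n - i) * (s ^ i - w ^ i)) \<in> M" for k
        by (induction k) (use I(2) I(3) in auto)
      then show ?thesis .
    qed
    finally have "e s - e w \<in> M" .
    then have "(s ^ n - w ^ n) - (e s - e w) \<in> M" using I(7)[OF diff] by blast
    then have "s ^ n - e s \<in> M" using \<open>w ^ n = e w\<close> by simp
    moreover have eS: "e s \<in> p"
    proof -
      have "c i * x ^ (n - i) * s ^ i \<in> p" if "i < n" for i
      proof -
        have "x ^ (n - i) = x ^ (n - i - 1) * x" using power_minus_mult[of "n - i" x] that by simp
        then have "c i * x ^ (n - i) * s ^ i = (c i * x ^ (n - i - 1) * s ^ i) * x"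
          by (simp only: ac_simps)
        moreover have "c i * x ^ (n - i - 1) * s ^ i \<in> R"
          using c xR bs subdom_mult[OF R] subdom_power[OF R] by blast
        ultimately show ?thesis using J(4)[OF _ x] by (simp only:)
      qed
      then have "(\<Sum>i<k. c i * x ^ (n - i) * s ^ i) \<in> p" if "k \<le> n" for k
        using that by (induction k) (use J(2) J(3) in auto)
      then show ?thesis by (simp add: e_def)
    qed
    moreover have "s ^ n - e s \<in> R" using eS J(1) bs subdom_diff[OF R] subdom_power[OF R] by blast
    ultimately have "(s ^ n - e s) + e s \<in> p" using sub J(3) by blast
    then show False using primeidealD(4)[OF R p bs(2), of n] bs(3) by simp
  qed
  ultimately show ?thesis using idealD(1)[OF R primeidealD(1)[OF R p]] by blast
qed

end

lemma central_contract:
  assumes R: "subdom R" and S: "subdom S" and RS: "R \<subseteq> S" and q: "q \<in> C_Spec S"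
  shows "q \<inter> R \<in> C_Spec R"
proof (rule C_SpecI)
  show P: "primeideal (q \<inter> R) (ring_on R)"
    by (rule primeideal_contract[OF R S RS C_SpecD(1)[OF q]])
  show "central R (q \<inter> R)"
    unfolding central_def
  proof (intro conjI ballI impI)
    show "ideal (q \<inter> R) (ring_on R)" by (rule primeidealD(1)[OF R P])
    fix a b assume "a \<in> R" "b \<in> sums_of_squares (frac_field_of R)" "a\<^sup>2 + b \<in> q \<inter> R"
    then show "a \<in> q \<inter> R"
      using centralD[OF C_SpecD(2)[OF q], of a b] sums_of_squares_mono[OF frac_field_of_mono[OF RS]] RS
      by blast
  qed
qed

text \<open>A prime over \<open>p\<close> is found among the ideals that contain the elements \<open>y\<close> with \<open>y\<^sup>2\<close> bounded by
  an element of \<open>p\<close>, and that avoid the multiplicative set of all \<open>s\<^sup>2 + t\<close> with \<open>s \<notin> p\<close> and \<open>t\<close> a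
  sum of squares. Enlarging the usual set of squares by the sums of squares makes a maximal such
  ideal not only prime but central.\<close>

lemma central_lying_over:
  assumes R: "subdom R" and S: "subdom S" and RS: "R \<subseteq> S" and SF: "S \<subseteq> frac_field_of R"
    and int: "\<And>x. x \<in> S \<Longrightarrow> integral_over R x" and pC: "p \<in> C_Spec R"
  shows "\<exists>q\<in>C_Spec S. q \<inter> R = p"
proof -
  define F where "F = frac_field_of R"
  have FS: "frac_field_of S = F" using frac_field_of_eq[OF R RS SF] by (simp add: F_def)
  let ?T = "sums_of_squares F"
  have F: "subdom F" unfolding F_def by (rule subdom_frac_field_of[OF R])
  have RF: "R \<subseteq> F" and SF: "S \<subseteq> F" using RS SF by (auto simp: F_def)
  have T_F: "?T \<subseteq> F" by (rule sums_of_squares_subset[OF F])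
  have real: "real_domain R" using C_Spec_empty_if_not_real[OF R] pC by blast
  have p: "primeideal p (ring_on R)" and pc: "central R p" using C_SpecD[OF pC] by auto
  note P = primeidealD[OF R p] note Ip = idealD[OF R P(1)]
  define I0 where "I0 = {y \<in> S. \<exists>e\<in>p. e - y\<^sup>2 \<in> ?T}"
  define N where "N = {s\<^sup>2 + t | s t. s \<in> R - p \<and> t \<in> ?T} \<inter> S"
  have I0: "ideal I0 (ring_on S)"
    unfolding ideal_ring_on_iff[OF S]
  proof (intro conjI ballI)
    show "I0 \<subseteq> S" by (auto simp: I0_def)
    show "0 \<in> I0"
      unfolding I0_def using subdom_0[OF S] Ip(2) sums_of_squares_0 by (auto intro!: bexI[of _ 0])
  next
    fix x y assume "x \<in> I0" "y \<in> I0"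
    then obtain d e where *: "x \<in> S" "y \<in> S" "d \<in> p" "e \<in> p" "d - x\<^sup>2 \<in> ?T" "e - y\<^sup>2 \<in> ?T"
      by (auto simp: I0_def)
    \<comment> \<open>The parallelogram identity bounds (x+y)^2 by 2x^2 + 2y^2, hence by 2d +
      2e.\<close>
    have "(d - x\<^sup>2) + (d - x\<^sup>2) + ((e - y\<^sup>2) + (e - y\<^sup>2)) + (x - y)\<^sup>2 \<in> ?T"
      using * SF by (intro sums_of_squares_add sums_of_squares_square subdom_diff[OF F]) auto
    then have "(d + d) + (e + e) - (x + y)\<^sup>2 \<in> ?T" by (simp add: power2_eq_square algebra_simps)
    moreover have "(d + d) + (e + e) \<in> p" using * by (intro Ip(3))
    ultimately show "x + y \<in> I0" using * subdom_add[OF S] by (auto simp: I0_def)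
  next
    fix x y assume "x \<in> S" "y \<in> I0"
    then obtain e where *: "y \<in> S" "e \<in> p" "e - y\<^sup>2 \<in> ?T" by (auto simp: I0_def)
    \<comment> \<open>The archimedean bound for \<open>x\<close> gives (x y)^2 \<le> D e. That
      \<open>D\<close> is itself a sum of squares is used when it multiplies
      \<open>e - y^2\<close>.\<close>
    obtain D where D: "D \<in> R" "D \<in> ?T" "D - x\<^sup>2 \<in> ?T"
      using integral_square_bounded[OF R real _ int[OF \<open>x \<in> S\<close>]] \<open>x \<in> S\<close> SF unfolding F_def by blast
    have "D * (e - y\<^sup>2) + (D - x\<^sup>2) * y\<^sup>2 \<in> ?T"
      using * D SF by (intro sums_of_squares_add sums_of_squares_mult[OF F] sums_of_squares_square) auto
    then have "D * e - (x * y)\<^sup>2 \<in> ?T" by (simp add: power2_eq_square algebra_simps)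
    moreover have "D * e \<in> p" using * D by (intro Ip(4))
    ultimately show "x * y \<in> I0" using * \<open>x \<in> S\<close> subdom_mult[OF S] by (auto simp: I0_def)
  qed
  have p_I0: "p \<subseteq> I0"
  proof
    fix x assume x: "x \<in> p"
    then have "x\<^sup>2 \<in> p" using Ip(1) Ip(4)[of x x] by (auto simp: power2_eq_square)
    then show "x \<in> I0" unfolding I0_def using x Ip(1) RS sums_of_squares_0[of F]
      by (auto intro!: bexI[of _ "x\<^sup>2"])
  qed
  \<comment> \<open>If y = s^2 + t has y^2 \<le> e with \<open>e\<close> in \<open>p\<close>, then
    \<open>e\<close> is (s^2)^2 plus a sum of squares, and centrality of \<open>p\<close> puts s^2
    into \<open>p\<close>.\<close>
  have I0_N: "I0 \<inter> N = {}"
  proof -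
    have False if y: "y \<in> I0" "y \<in> N" for y
    proof -
      obtain e where e: "e \<in> p" "e - y\<^sup>2 \<in> ?T" using y by (auto simp: I0_def)
      obtain s t where st: "s \<in> R" "s \<notin> p" "t \<in> ?T" "y = s\<^sup>2 + t" using y by (auto simp: N_def)
      have "s\<^sup>2 * t + s\<^sup>2 * t + t\<^sup>2 + (e - y\<^sup>2) \<in> ?T"
        using e st RF T_F
        by (intro sums_of_squares_add sums_of_squares_mult[OF F] sums_of_squares_square) auto
      moreover have "(s\<^sup>2)\<^sup>2 + (s\<^sup>2 * t + s\<^sup>2 * t + t\<^sup>2 + (e - y\<^sup>2)) = e"
        unfolding st(4) by (simp add: power2_eq_square algebra_simps)
      ultimately have "s\<^sup>2 \<in> p"
        using centralD[OF pc subdom_power[OF R st(1), of 2]] e(1) unfolding F_def by metis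
      then show False using P(4)[OF st(1)] st(2) by blast
    qed
    then show ?thesis by blast
  qed
  have N_mult: "x * y \<in> N" if xy: "x \<in> N" "y \<in> N" for x y
  proof -
    obtain s t s' t' where st: "s \<in> R - p" "t \<in> ?T" "x = s\<^sup>2 + t" "s' \<in> R - p" "t' \<in> ?T" "y = s'\<^sup>2 + t'"
      using xy by (auto simp: N_def)
    have "x * y = (s * s')\<^sup>2 + (s\<^sup>2 * t' + t * s'\<^sup>2 + t * t')"
      unfolding st by (simp add: power2_eq_square algebra_simps)
    moreover have "s\<^sup>2 * t' + t * s'\<^sup>2 + t * t' \<in> ?T"
      using st RF by (intro sums_of_squares_add sums_of_squares_mult[OF F] sums_of_squares_square) auto
    moreover have "s * s' \<in> R - p" using P(5) st by blast
    moreover have "x * y \<in> S" using xy subdom_mult[OF S] by (auto simp: N_def)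
    ultimately show ?thesis unfolding N_def by blast
  qed
  define \<A> where "\<A> = {J. ideal J (ring_on S) \<and> I0 \<subseteq> J \<and> J \<inter> N = {}}"
  have "\<exists>J\<in>\<A>. \<forall>K\<in>\<A>. J \<subseteq> K \<longrightarrow> K = J"
  proof (rule subset_Zorn_nonempty)
    show "\<A> \<noteq> {}" using I0 I0_N by (auto simp: \<A>_def)
    fix C assume "C \<noteq> {}" and C: "subset.chain \<A> C"
    have CA: "ideal J (ring_on S)" "I0 \<subseteq> J" "J \<inter> N = {}" if "J \<in> C" for J
      using that C by (auto simp: \<A>_def subset.chain_def)
    have "ideal (\<Union>C) (ring_on S)"
      unfolding ideal_ring_on_iff[OF S]
    proof (intro conjI ballI)
      show "\<Union>C \<subseteq> S" using idealD(1)[OF S CA(1)] by blast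
      show "0 \<in> \<Union>C" using idealD(2)[OF S CA(1)] \<open>C \<noteq> {}\<close> by blast
      show "x * y \<in> \<Union>C" if xy: "x \<in> S" "y \<in> \<Union>C" for x y
        using idealD(4)[OF S CA(1) xy(1)] xy(2) by blast
      show "x + y \<in> \<Union>C" if xy: "x \<in> \<Union>C" "y \<in> \<Union>C" for x y
      proof -
        obtain J K where JK: "J \<in> C" "K \<in> C" "x \<in> J" "y \<in> K" using xy by blast
        then have "J \<subseteq> K \<or> K \<subseteq> J" using C by (auto simp: subset.chain_def)
        then show ?thesis
          using idealD(3)[OF S CA(1)[OF JK(1)], of x y] idealD(3)[OF S CA(1)[OF JK(2)], of x y] JK
          by blast
      qed
    qed
    moreover have "I0 \<subseteq> \<Union>C" using CA(2) \<open>C \<noteq> {}\<close> by blast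
    moreover have "\<Union>C \<inter> N = {}" using CA(3) by blast
    ultimately show "\<Union>C \<in> \<A>" by (simp add: \<A>_def)
  qed
  then obtain q where q: "ideal q (ring_on S)" "I0 \<subseteq> q" "q \<inter> N = {}"
    and max: "\<And>K. ideal K (ring_on S) \<Longrightarrow> q \<subseteq> K \<Longrightarrow> K \<inter> N = {} \<Longrightarrow> K = q"
    by (auto simp: \<A>_def)
  note I = idealD[OF S q(1)]
  have meet: "\<exists>y\<in>S. \<exists>z\<in>q. x * y + z \<in> N" if x: "x \<in> S" "x \<notin> q" for x
  proof (rule ccontr)
    assume no: "\<not> (\<exists>y\<in>S. \<exists>z\<in>q. x * y + z \<in> N)"
    let ?J = "{x * y + z | y z. y \<in> S \<and> z \<in> q}"
    note J = ideal_add_principal[OF S q(1) x(1)]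
    have "?J \<inter> N = {}" using no by blast
    then show False using max[OF J(1,2)] J(3) x(2) by blast
  qed
  have N1: "1 \<in> N"
  proof -
    have "1 = 1\<^sup>2 + (0 :: 'a)" by simp
    then show ?thesis
      unfolding N_def using subdom_1[OF R] subdom_1[OF S] P(2) sums_of_squares_0[of F] by blast
  qed
  have "primeideal q (ring_on S)"
    unfolding primeideal_ring_on_iff[OF S]
  proof (intro conjI ballI impI)
    show "ideal q (ring_on S)" by (rule q)
    show "1 \<notin> q" using q(3) N1 by blast
    fix x y assume xy: "x \<in> S" "y \<in> S" "x * y \<in> q"
    show "x \<in> q \<or> y \<in> q"
    proof (rule ccontr)
      assume "\<not> (x \<in> q \<or> y \<in> q)"
      then obtain a z b w where *: "a \<in> S" "z \<in> q" "x * a + z \<in> N" "b \<in> S" "w \<in> q" "y * b + w \<in> N"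
        using meet xy by metis
      have "(x * a + z) * (y * b + w) = (x * y) * (a * b) + ((x * a) * w + (y * b + w) * z)"
        by (simp add: algebra_simps)
      also have "\<dots> \<in> q"
      proof (intro I(3))
        show "(x * y) * (a * b) \<in> q" using xy(3) * subdom_mult[OF S] I(5) by blast
        show "(x * a) * w \<in> q" using * xy subdom_mult[OF S] I(4) by blast
        show "(y * b + w) * z \<in> q" using * I(4)[of "y * b + w" z] by (auto simp: N_def)
      qed
      finally show False using N_mult[OF *(3,6)] q(3) by blast
    qed
  qed
  moreover have "central S q"
    unfolding central_def FS
  proof (intro conjI ballI impI)
    show "ideal q (ring_on S)" by (rule q)
    fix x t assume x: "x \<in> S" and t: "t \<in> ?T" and xt: "x\<^sup>2 + t \<in> q"
    show "x \<in> q"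
    proof (rule ccontr)
      assume "x \<notin> q"
      then obtain y z where yz: "y \<in> S" "z \<in> q" "x * y + z \<in> N" using meet x by blast
      \<comment> \<open>The element n^2 + t y^2 is congruent to (x^2 + t) y^2 modulo
        \<open>q\<close>, hence in \<open>q\<close>. Being a square of an element of
        \<open>N\<close> plus a sum of squares, it also has the shape required by \<open>N\<close>;
        its membership in \<open>S\<close>, where \<open>t\<close> alone need not lie, comes from
        its being in \<open>q\<close>.\<close>
      define n where "n = x * y + z"
      obtain s u where su: "s \<in> R - p" "u \<in> ?T" "n = s\<^sup>2 + u" using yz(3) by (auto simp: N_def n_def)
      have n: "n \<in> S" using yz(3) by (simp add: N_def n_def)
      have "n\<^sup>2 + t * y\<^sup>2 = (x\<^sup>2 + t) * y\<^sup>2 + (n + x * y) * z"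
        by (simp add: n_def power2_eq_square algebra_simps)
      also have "\<dots> \<in> q"
      proof (rule I(3))
        show "(x\<^sup>2 + t) * y\<^sup>2 \<in> q" by (rule I(5)[OF xt subdom_power[OF S yz(1)]])
        show "(n + x * y) * z \<in> q"
          by (rule I(4)[OF subdom_add[OF S n subdom_mult[OF S x yz(1)]] yz(2)])
      qed
      finally have nq: "n\<^sup>2 + t * y\<^sup>2 \<in> q" .
      have "n\<^sup>2 + t * y\<^sup>2 = (s\<^sup>2)\<^sup>2 + (s\<^sup>2 * u + s\<^sup>2 * u + u\<^sup>2 + t * y\<^sup>2)"
        by (simp add: su(3) power2_eq_square algebra_simps)
      moreover have "s\<^sup>2 * u + s\<^sup>2 * u + u\<^sup>2 + t * y\<^sup>2 \<in> ?T"
        using su t yz RF SF T_F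
        by (intro sums_of_squares_add sums_of_squares_mult[OF F] sums_of_squares_square) auto
      moreover have "s\<^sup>2 \<in> R - p" using P(5)[OF su(1) su(1)] by (simp add: power2_eq_square)
      ultimately have "n\<^sup>2 + t * y\<^sup>2 \<in> N" unfolding N_def using nq I(1) by blast
      then show False using nq q(3) by blast
    qed
  qed
  moreover have "q \<inter> R = p"
  proof
    show "p \<subseteq> q \<inter> R" using p_I0 q(2) Ip(1) by blast
    show "q \<inter> R \<subseteq> p"
    proof
      fix x assume x: "x \<in> q \<inter> R"
      show "x \<in> p"
      proof (rule ccontr)
        assume "x \<notin> p"
        have "x \<in> R" "x \<in> S" "x \<in> q" using x RS by auto
        have "x\<^sup>2 + 0 \<in> q" using I(4)[OF \<open>x \<in> S\<close> \<open>x \<in> q\<close>] by (simp add: power2_eq_square)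
        moreover have "x\<^sup>2 + 0 \<in> N"
          unfolding N_def
        proof (intro IntI CollectI exI conjI)
          show "x \<in> R - p" using \<open>x \<in> R\<close> \<open>x \<notin> p\<close> by blast
          show "x\<^sup>2 + 0 \<in> S" using subdom_power[OF S \<open>x \<in> S\<close>] by simp
        qed (rule refl sums_of_squares_0)+
        ultimately show False using q(3) by blast
      qed
    qed
  qed
  ultimately show ?thesis using C_SpecI by blast
qed

section \<open>The central gluing\<close>

lemma integral_over_mono: "R \<subseteq> S \<Longrightarrow> integral_over R x \<Longrightarrow> integral_over S x"
  by (auto simp: integral_over_def)

lemma ideal_Rad_C:
  assumes L: "subdom L" shows "ideal (Rad_C L) (ring_on L)"
  unfolding ideal_ring_on_iff[OF L] Rad_C_def
proof (intro conjI ballI IntI InterI)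
  fix M assume M: "M \<in> {m. maximalideal m (ring_on L) \<and> central L m}"
  then have "ideal M (ring_on L)" by (simp add: maximalideal_ring_on_iff[OF L])
  note I = idealD[OF L this]
  show "0 \<in> M" by (rule I)
  fix x y assume "y \<in> L \<inter> \<Inter>{m. maximalideal m (ring_on L) \<and> central L m}"
  then have y: "y \<in> M" using M by blast
  show "x * y \<in> M" if "x \<in> L" using I(4)[OF that y] .
  show "x + y \<in> M" if "x \<in> L \<inter> \<Inter>{m. maximalideal m (ring_on L) \<and> central L m}"
    using I(3)[of x y] that y M by blast
qed (auto intro: subdom_0[OF L] subdom_add[OF L] subdom_mult[OF L])

context
  fixes R S :: "'k::field set"
  assumes R: "subdom R" and S: "subdom S" and RS: "R \<subseteq> S" and SF: "S \<subseteq> frac_field_of R"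
    and int: "\<And>x. x \<in> S \<Longrightarrow> integral_over R x"
begin

lemma central_gluing_subset: "central_gluing R S \<subseteq> S"
  by (auto simp: central_gluing_def)

lemma central_gluingE:
  assumes "b \<in> central_gluing R S" "p \<in> C_Spec R"
  obtains a r where "b = a + r" "a \<in> loc R p R" "r \<in> Rad_C (loc R p S)"
  using assms by (auto simp: central_gluing_def)

lemma subdom_central_gluing: "subdom (central_gluing R S)" and base_subset_central_gluing: "R \<subseteq> central_gluing R S"
proof -
  show RG: "R \<subseteq> central_gluing R S"
  proof
    fix x assume x: "x \<in> R"
    have "x \<in> {a + r | a r. a \<in> loc R p R \<and> r \<in> Rad_C (loc R p S)}" if p: "p \<in> C_Spec R" for p
    proof (intro CollectI exI conjI)
      show "x \<in> loc R p R" using subset_loc[OF R C_SpecD(1)[OF p]] x by blast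
      show "0 \<in> Rad_C (loc R p S)"
        using idealD(2)[OF _ ideal_Rad_C] subdom_loc[OF R S RS C_SpecD(1)[OF p]] by blast
    qed simp
    then show "x \<in> central_gluing R S" using x RS by (auto simp: central_gluing_def)
  qed
  show "subdom (central_gluing R S)"
  proof (rule subdomI)
    show "1 \<in> central_gluing R S" using RG subdom_1[OF R] by blast
    fix x y assume xy: "x \<in> central_gluing R S" "y \<in> central_gluing R S"
    have xyS: "x \<in> S" "y \<in> S" using xy central_gluing_subset by auto
    have *: "x - y \<in> {a + r | a r. a \<in> loc R p R \<and> r \<in> Rad_C (loc R p S)} \<and>
        x * y \<in> {a + r | a r. a \<in> loc R p R \<and> r \<in> Rad_C (loc R p S)}" if p: "p \<in> C_Spec R" for p
    proof -
      note p' = C_SpecD(1)[OF p]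
      have L: "subdom (loc R p S)" and K: "subdom (loc R p R)"
        by (rule subdom_loc[OF R S RS p'] subdom_loc[OF R R order_refl p'])+
      note I = idealD[OF L ideal_Rad_C[OF L]]
      have KL: "loc R p R \<subseteq> loc R p S" using RS by (auto simp: loc_def)
      obtain a r where a: "x = a + r" "a \<in> loc R p R" "r \<in> Rad_C (loc R p S)"
        using xy(1) p by (rule central_gluingE)
      obtain b s where b: "y = b + s" "b \<in> loc R p R" "s \<in> Rad_C (loc R p S)"
        using xy(2) p by (rule central_gluingE)
      \<comment> \<open>Differences and products of approximations have errors in the radical, which
        is an ideal of the localization of \<open>S\<close> and so absorbs the factors a + r and
        b.\<close>
      have "x - y = (a - b) + (r - s)" "x * y = a * b + ((a + r) * s + b * r)"
        using a b by (simp_all add: algebra_simps)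
      moreover have "a - b \<in> loc R p R" "a * b \<in> loc R p R"
        using a b by (auto intro: subdom_diff[OF K] subdom_mult[OF K])
      moreover have "r - s \<in> Rad_C (loc R p S)" using a b by (intro I(7))
      moreover have "(a + r) * s + b * r \<in> Rad_C (loc R p S)"
        using a b KL I(1) by (intro I(3) I(4) subdom_add[OF L]) auto
      ultimately show ?thesis by blast
    qed
    show "x - y \<in> central_gluing R S" "x * y \<in> central_gluing R S"
      using * subdom_diff[OF S xyS] subdom_mult[OF S xyS] unfolding central_gluing_def by simp_all
  qed
qed

text \<open>The order of quantifiers is the point: one fraction a/s serves all central primes over
  \<open>p\<close>. Each of them localizes to a maximal central ideal, and the error term, lying in
  the central radical, belongs to all of these.\<close>

lemma central_gluing_approx:
  assumes b: "b \<in> central_gluing R S" and p: "p \<in> C_Spec R"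
  shows "\<exists>a\<in>R. \<exists>s\<in>R - p. \<forall>q\<in>C_Spec S. q \<inter> R = p \<longrightarrow> s * b - a \<in> q"
proof -
  note p' = C_SpecD(1)[OF p]
  obtain x r where x: "b = x + r" "x \<in> loc R p R" "r \<in> Rad_C (loc R p S)"
    using b p by (rule central_gluingE)
  obtain a s where as: "a \<in> R" "s \<in> R" "s \<notin> p" "x = a / s" using x(2) by (rule locE)
  have s: "s \<noteq> 0" "s \<in> S" "a \<in> S" using primeidealD(6)[OF R p', of s] as RS by auto
  have bS: "b \<in> S" using b central_gluing_subset by blast
  have "s * b - a \<in> q" if q: "q \<in> C_Spec S" and qp: "q \<inter> R = p" for q
  proof -
    note Q = C_SpecD[OF q]
    have L: "subdom (loc R p S)" by (rule subdom_loc[OF R S RS p'])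
    have qp': "q \<inter> R \<subseteq> p" using qp by simp
    have "maximalideal (loc R p q) (ring_on (loc R p S))"
      by (rule maximalideal_loc[OF R S RS p' int Q(1) qp])
    moreover have "central (loc R p S) (loc R p q)"
      by (rule central_loc[OF R S RS p' Q qp'])
    ultimately have r: "r \<in> loc R p q" using x(3) by (auto simp: Rad_C_def)
    have "s * r \<in> loc R p q"
      using idealD(4)[OF L ideal_loc[OF R S RS p' primeidealD(1)[OF S Q(1)]] _ r]
        subset_loc[OF R p'] s(2) by blast
    moreover have "s * r = s * b - a" using x(1) as(4) s(1) by (simp add: algebra_simps)
    moreover have "s * b - a \<in> S" using s bS by (intro subdom_diff[OF S] subdom_mult[OF S])
    ultimately show ?thesis using loc_prime_mem[OF R S RS p' Q(1) qp'] by simp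
  qed
  then show ?thesis using as by blast
qed

text \<open>Surjectivity on central primes comes from lying over for \<open>S\<close>, followed by
  contraction to the gluing. The common approximating fractions give both injectivity and equality
  of residue fields.\<close>

lemma sc_subintegral_central_gluing: "sc_subintegral R (central_gluing R S)"
proof -
  define G where "G = central_gluing R S"
  have G: "subdom G" and RG: "R \<subseteq> G" and GS: "G \<subseteq> S"
    unfolding G_def by (rule subdom_central_gluing base_subset_central_gluing central_gluing_subset)+
  have SG: "S \<subseteq> frac_field_of G" using SF frac_field_of_mono[OF RG] by blast
  \<comment> \<open>The approximation speaks about primes of \<open>S\<close>, so primes of
    \<open>G\<close> are lifted first. Lying over applies because \<open>S\<close> is also integral
    and birational over \<open>G\<close>.\<close>
  have lift: "\<exists>q'\<in>C_Spec S. q' \<inter> G = q" if "q \<in> C_Spec G" for q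
    by (rule central_lying_over[OF G S GS SG integral_over_mono[OF RG int] that])
  have approx: "\<exists>a\<in>R. \<exists>s\<in>R - p. \<forall>q\<in>C_Spec S. q \<inter> R = p \<longrightarrow> s * b - a \<in> q"
    if "b \<in> G" "p \<in> C_Spec R" for b p
    using central_gluing_approx that unfolding G_def by blast
  \<comment> \<open>The element s b - a lies in both lifts. If \<open>b\<close> is in
    \<open>Q1\<close>, so is \<open>a\<close>; the lifts agree on \<open>R\<close>, hence
    \<open>a\<close>, s b and finally \<open>b\<close> lie in \<open>Q2\<close>.\<close>
  have sub: "q1 \<subseteq> q2" if q: "q1 \<in> C_Spec G" "q2 \<in> C_Spec G" and eq: "q1 \<inter> R = q2 \<inter> R" for q1 q2
  proof
    fix b assume b: "b \<in> q1"
    have bG: "b \<in> G" using b idealD(1)[OF G primeidealD(1)[OF G C_SpecD(1)[OF q(1)]]] by blast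
    obtain Q1 where Q1: "Q1 \<in> C_Spec S" "Q1 \<inter> G = q1" using lift q(1) by blast
    obtain Q2 where Q2: "Q2 \<in> C_Spec S" "Q2 \<inter> G = q2" using lift q(2) by blast
    note P1 = primeidealD[OF S C_SpecD(1)[OF Q1(1)]] note I1 = idealD[OF S P1(1)]
    note P2 = primeidealD[OF S C_SpecD(1)[OF Q2(1)]] note I2 = idealD[OF S P2(1)]
    have QR: "Q1 \<inter> R = q1 \<inter> R" "Q2 \<inter> R = q1 \<inter> R" using Q1 Q2 eq RG by blast+
    obtain a s where as: "a \<in> R" "s \<in> R - q1 \<inter> R"
      "\<forall>q\<in>C_Spec S. q \<inter> R = q1 \<inter> R \<longrightarrow> s * b - a \<in> q"
      using approx[OF bG central_contract[OF R G RG q(1)]] by blast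
    have sS: "s \<in> S" "b \<in> S" using as RS bG GS by auto
    have 1: "s * b - a \<in> Q1" "s * b - a \<in> Q2" using as(3) Q1(1) Q2(1) QR by auto
    have "b \<in> Q1" using b Q1 by blast
    then have "s * b - (s * b - a) \<in> Q1" using I1(7)[OF I1(4)[OF sS(1)] 1(1)] by blast
    then have "a \<in> Q1 \<inter> R" using as(1) by simp
    then have "a \<in> Q2" using QR by blast
    then have "(s * b - a) + a \<in> Q2" using I2(3)[OF 1(2)] by blast
    then have "s * b \<in> Q2" by simp
    moreover have "s \<notin> Q2" using as(2) QR(2) by blast
    ultimately have "b \<in> Q2" using P2(3)[OF sS] by blast
    then show "b \<in> q2" using Q2(2) bG by blast
  qed
  have "bij_betw (\<lambda>q. q \<inter> R) (C_Spec G) (C_Spec R)"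
    unfolding bij_betw_def
  proof
    show "inj_on (\<lambda>q. q \<inter> R) (C_Spec G)"
      by (rule inj_onI, rule subset_antisym) (rule sub; simp)+
    show "(\<lambda>q. q \<inter> R) ` C_Spec G = C_Spec R"
    proof (rule subset_antisym)
      show "(\<lambda>q. q \<inter> R) ` C_Spec G \<subseteq> C_Spec R" using central_contract[OF R G RG] by blast
      show "C_Spec R \<subseteq> (\<lambda>q. q \<inter> R) ` C_Spec G"
      proof
        fix p assume p: "p \<in> C_Spec R"
        obtain Q where Q: "Q \<in> C_Spec S" "Q \<inter> R = p"
          using central_lying_over[OF R S RS SF int p] by blast
        have "p = (Q \<inter> G) \<inter> R" using Q RG by blast
        then show "p \<in> (\<lambda>q. q \<inter> R) ` C_Spec G" using central_contract[OF G S GS Q(1)] by blast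
      qed
    qed
  qed
  moreover have "residue_map G q \<in> ring_iso (residue_field R (q \<inter> R)) (residue_field G q)"
    if q: "q \<in> C_Spec G" for q
    unfolding residue_map_iso_iff[OF R G RG C_SpecD(1)[OF q]]
  proof
    fix b assume b: "b \<in> G"
    obtain Q where Q: "Q \<in> C_Spec S" "Q \<inter> G = q" using lift q by blast
    then have "Q \<inter> R = q \<inter> R" using RG by blast
    then obtain a s where as: "a \<in> R" "s \<in> R - q \<inter> R" "s * b - a \<in> Q"
      using approx[OF b central_contract[OF R G RG q]] Q(1) by blast
    have "a \<in> G" "s \<in> G" using as RG by auto
    then have "s * b - a \<in> q"
      using Q(2) as(3) subdom_diff[OF G subdom_mult[OF G _ b]] by blast
    then show "\<exists>a\<in>R. \<exists>s\<in>R - q. s * b - a \<in> q" using as by blast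
  qed
  ultimately show ?thesis
    using int GS unfolding sc_subintegral_def G_def[symmetric] by blast
qed

text \<open>Equality of residue fields at the unique central prime \<open>q\<close> of
  \<open>C\<close> over \<open>p\<close> yields a fraction a/s approximating \<open>c\<close>.
  Uniqueness of \<open>q\<close> makes the error lie in every maximal central ideal of the
  localization of \<open>S\<close>.\<close>

lemma sc_subintegral_subset_central_gluing:
  assumes C: "subdom C" and RC: "R \<subseteq> C" and CS: "C \<subseteq> S" and sc: "sc_subintegral R C"
  shows "C \<subseteq> central_gluing R S"
proof
  fix c assume c: "c \<in> C"
  have bij: "bij_betw (\<lambda>q. q \<inter> R) (C_Spec C) (C_Spec R)" using sc by (simp add: sc_subintegral_def)
  have "c \<in> {a + r | a r. a \<in> loc R p R \<and> r \<in> Rad_C (loc R p S)}" if p: "p \<in> C_Spec R" for p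
  proof -
    note p' = C_SpecD(1)[OF p]
    let ?L = "loc R p S"
    have L: "subdom ?L" by (rule subdom_loc[OF R S RS p'])
    have SL: "S \<subseteq> ?L" by (rule subset_loc[OF R p'])
    have "p \<in> (\<lambda>q. q \<inter> R) ` C_Spec C"
      unfolding bij_betw_imp_surj_on[OF bij] by (rule p)
    then obtain q where q: "q \<in> C_Spec C" "q \<inter> R = p" by (elim imageE) (rule that[OF _ sym])
    have "residue_map C q \<in> ring_iso (residue_field R (q \<inter> R)) (residue_field C q)"
      using sc q(1) by (simp add: sc_subintegral_def)
    then obtain a s where as: "a \<in> R" "s \<in> R - q" "s * c - a \<in> q"
      using c unfolding residue_map_iso_iff[OF R C RC C_SpecD(1)[OF q(1)]] by blast
    have sp: "s \<in> R" "s \<notin> p" using as q by auto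
    then have s0: "s \<noteq> 0" using primeidealD(6)[OF R p', of s] by auto
    have sc_C: "s * c - a \<in> C" using as c RC C by (intro subdom_diff subdom_mult) auto
    have inv: "1 / s \<in> ?L" using sp subdom_1[OF S] by (auto intro: locI)
    have "(s * c - a) / s \<in> Rad_C ?L"
      unfolding Rad_C_def
    proof (intro IntI InterI)
      show "(s * c - a) / s \<in> ?L" using sc_C CS sp by (auto intro: locI)
      fix M assume "M \<in> {m. maximalideal m (ring_on ?L) \<and> central ?L m}"
      then have M: "maximalideal M (ring_on ?L)" "central ?L M" by auto
      have M': "primeideal M (ring_on ?L)" by (rule maximalideal_imp_primeideal[OF L M(1)])
      have CL: "C \<subseteq> ?L" using CS SL by blast
      \<comment> \<open>Whatever \<open>M\<close> is, its trace on \<open>C\<close> is a central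
        prime over \<open>p\<close>, and injectivity of contraction identifies this trace with
        \<open>q\<close>.\<close>
      have "M \<inter> C \<in> C_Spec C" by (rule central_contract[OF C L CL C_SpecI[OF M' M(2)]])
      moreover have "M \<inter> R = p" by (rule maximalideal_loc_contract[OF R S RS p' int M(1)])
      then have "(M \<inter> C) \<inter> R = q \<inter> R" using q(2) RC by blast
      ultimately have "M \<inter> C = q" using inj_onD[OF bij_betw_imp_inj_on[OF bij]] q(1) by blast
      then have "s * c - a \<in> M" using as(3) by blast
      then have "(s * c - a) * (1 / s) \<in> M"
        by (rule idealD(5)[OF L primeidealD(1)[OF L M'] _ inv])
      then show "(s * c - a) / s \<in> M" by simp
    qed
    moreover have "a / s \<in> loc R p R" using as(1) sp by (rule locI)
    moreover have "c = a / s + (s * c - a) / s" using s0 by (simp add: field_simps)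
    ultimately show ?thesis by blast
  qed
  then show "c \<in> central_gluing R S" using c CS unfolding central_gluing_def by blast
qed

end

text \<open>For a real domain the zero ideal is central, so its residue field, the fraction field, is
  preserved.\<close>

lemma sc_subintegral_birational:
  assumes R: "subdom R" and C: "subdom C" and RC: "R \<subseteq> C" and sc: "sc_subintegral R C"
    and real: "real_domain R"
  shows "C \<subseteq> frac_field_of R"
proof
  fix c assume c: "c \<in> C"
  have "{0} \<in> (\<lambda>q. q \<inter> R) ` C_Spec C"
    using sc zero_in_C_Spec[OF R real] by (simp add: sc_subintegral_def bij_betw_def)
  then obtain q where q: "q \<in> C_Spec C" "q \<inter> R = {0}" by blast
  note q' = C_SpecD(1)[OF q(1)]
  \<comment> \<open>Integrality allows only the zero ideal over zero. Equiresiduality there says s c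
    = a exactly, with nonzero \<open>s\<close>.\<close>
  have "q = {0}"
    by (rule zero_ideal_lies_over_zero[OF R C RC _ q' q(2)]) (use sc in \<open>simp add: sc_subintegral_def\<close>)
  moreover have "residue_map C q \<in> ring_iso (residue_field R (q \<inter> R)) (residue_field C q)"
    using sc q(1) by (simp add: sc_subintegral_def)
  ultimately obtain a s where "a \<in> R" "s \<in> R - {0}" "s * c - a \<in> {0}"
    using c unfolding residue_map_iso_iff[OF R C RC q'] by blast
  then have "c = a / s" by (simp add: field_simps)
  then show "c \<in> frac_field_of R" using \<open>a \<in> R\<close> \<open>s \<in> R - {0}\<close> by (auto intro: frac_field_ofI)
qed

section \<open>Existence and identification of the central seminormalization\<close>

lemma central_seminormalization_eqI:
  assumes G: "sc_intermediate A B G" and le: "\<And>C. sc_intermediate A B C \<Longrightarrow> C \<subseteq> G"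
  shows "central_seminormalization_exists A B" "central_seminormalization A B = G"
proof -
  \<comment> \<open>A greatest element is the only maximal one, which settles both the existence
    claim and the definite description.\<close>
  have iff: "maximal_sc_intermediate A B C \<longleftrightarrow> C = G" for C
    using G le unfolding maximal_sc_intermediate_def by (metis subset_antisym)
  show "central_seminormalization_exists A B"
    by (simp add: central_seminormalization_exists_def iff)
  show "central_seminormalization A B = G"
    by (simp add: central_seminormalization_def iff)
qed

lemma integral_birational_closure_facts:
  assumes A: "subdom A" and B: "subdom B" and AB: "A \<subseteq> B"
  shows "subdom (integral_birational_closure_in A B)" "A \<subseteq> integral_birational_closure_in A B"
    "integral_birational_closure_in A B \<subseteq> B" "integral_birational_closure_in A B \<subseteq> frac_field_of A"
    "\<And>x. x \<in> integral_birational_closure_in A B \<Longrightarrow> integral_over A x"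
proof -
  have F: "subdom (frac_field_of A)" by (rule subdom_frac_field_of[OF A])
  have AF: "A \<subseteq> frac_field_of A" by (rule subset_frac_field_of[OF subdom_1[OF A]])
  have D: "subdom (birational_closure_in A B)"
    by (rule subdomI) (auto simp: birational_closure_in_def
        intro: subdom_1 subdom_diff subdom_mult B F)
  have AD: "A \<subseteq> birational_closure_in A B" using AB AF by (auto simp: birational_closure_in_def)
  show "subdom (integral_birational_closure_in A B)" "A \<subseteq> integral_birational_closure_in A B"
    unfolding integral_birational_closure_in_def by (rule subdom_integral_closure_in[OF A D AD])+
  show "integral_birational_closure_in A B \<subseteq> B" "integral_birational_closure_in A B \<subseteq> frac_field_of A"
    "\<And>x. x \<in> integral_birational_closure_in A B \<Longrightarrow> integral_over A x"
    by (auto simp: integral_birational_closure_in_def integral_closure_in_def birational_closure_in_def)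
qed

lemma central_seminormalization_real:
  assumes A: "subdom A" and B: "subdom B" and AB: "A \<subseteq> B" and real: "real_domain A"
  shows "central_seminormalization_exists A B"
    "central_seminormalization A B = central_gluing A (integral_birational_closure_in A B)"
proof -
  let ?D = "integral_birational_closure_in A B"
  note D = integral_birational_closure_facts[OF A B AB]
  have G: "sc_intermediate A B (central_gluing A ?D)"
    unfolding sc_intermediate_def
  proof (intro conjI)
    show "subdom (central_gluing A ?D)"
      by (rule subdom_central_gluing[OF A D(1,2,4)]) (rule D(5))
    show "A \<subseteq> central_gluing A ?D"
      by (rule base_subset_central_gluing[OF A D(1,2,4)]) (rule D(5))
    show "central_gluing A ?D \<subseteq> B"
      using D(3) by (auto simp: central_gluing_def)
    show "sc_subintegral A (central_gluing A ?D)"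
      by (rule sc_subintegral_central_gluing[OF A D(1,2,4)]) (rule D(5))
  qed
  have le: "C \<subseteq> central_gluing A ?D" if C: "sc_intermediate A B C" for C
  proof -
    have C': "subdom C" "A \<subseteq> C" "C \<subseteq> B" "sc_subintegral A C"
      using C by (auto simp: sc_intermediate_def)
    have "C \<subseteq> frac_field_of A" by (rule sc_subintegral_birational[OF A C'(1,2,4) real])
    then have CD: "C \<subseteq> ?D"
      using C'(3,4) by (auto simp: integral_birational_closure_in_def integral_closure_in_def
          birational_closure_in_def sc_subintegral_def)
    show ?thesis
      by (rule sc_subintegral_subset_central_gluing[OF A D(1,2,4) _ C'(1,2) CD C'(4)]) (rule D(5))
  qed
  show "central_seminormalization_exists A B"
    "central_seminormalization A B = central_gluing A ?D"
    by (rule central_seminormalization_eqI[OF G le]; assumption)+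
qed

text \<open>Neither \<open>A\<close> nor its integral closure has central primes, so the conditions
  on primes and residue fields hold vacuously. Integrality remains, and it is also the only
  restriction on the intermediate rings to be compared. The gluing condition over an empty spectrum
  is vacuous too.\<close>

lemma central_seminormalization_not_real:
  assumes A: "subdom A" and B: "subdom B" and AB: "A \<subseteq> B" and nonreal: "\<not> real_domain A"
  shows "central_seminormalization_exists A B"
    "central_seminormalization A B = integral_closure_in A B"
    "central_gluing A (integral_closure_in A B) = integral_closure_in A B"
proof -
  let ?D = "integral_closure_in A B"
  note D = subdom_integral_closure_in[OF A B AB]
  have emp: "C_Spec A = {}" by (rule C_Spec_empty_if_not_real[OF A nonreal])
  have "C_Spec ?D = {}"
    using C_Spec_empty_if_not_real[OF D(1)] real_domain_antimono[OF D(2)] nonreal by blast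
  then have G: "sc_intermediate A B ?D"
    using D emp by (auto simp: bij_betw_def sc_intermediate_def sc_subintegral_def integral_closure_in_def)
  have le: "C \<subseteq> ?D" if "sc_intermediate A B C" for C
    using that by (auto simp: sc_intermediate_def sc_subintegral_def integral_closure_in_def)
  show "central_seminormalization_exists A B" "central_seminormalization A B = ?D"
    by (rule central_seminormalization_eqI[OF G le]; assumption)+
  show "central_gluing A ?D = ?D" by (simp add: central_gluing_def emp)
qed

theorem theorem5p34:
  fixes f :: "'a::idom \<Rightarrow> 'b::idom"
    and A B :: "'b fract set"
  assumes rat: "contains_rationals TYPE('a)" "contains_rationals TYPE('b)"
    and hom: "f \<in> ring_hom ring_of_type_algebra ring_of_type_algebra"
    and inj: "inj f"
    and A: "A = range (\<lambda>a. to_fract (f a))"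
    and B: "B = range to_fract"
  shows "central_seminormalization_exists A B \<and>
    (real_domain A \<longrightarrow>
       central_seminormalization A B = central_gluing A (integral_birational_closure_in A B) \<and>
       central_gluing A (integral_birational_closure_in A B) =
         {b \<in> integral_birational_closure_in A B. \<forall>p\<in>C_Spec A.
            b \<in> {a + r | a r. a \<in> loc A p A \<and>
                   r \<in> Rad_C (loc A p (integral_birational_closure_in A B))}}) \<and>
    (\<not> real_domain A \<longrightarrow>
       central_seminormalization A B = integral_closure_in A B \<and>
       integral_closure_in A B = central_gluing A (integral_closure_in A B))"
proof -
  have f: "f (x * y) = f x * f y" "f (x + y) = f x + f y" "f 1 = 1" for x y
    using ring_hom_mult[OF hom, of x y] ring_hom_add[OF hom, of x y] ring_hom_one[OF hom]
    by (simp_all add: ring_of_type_algebra_def)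
  have f_diff: "f (x - y) = f x - f y" for x y
    using f(2)[of "x - y" y] by simp
  \<comment> \<open>It remains to see that the images of both rings in the fraction field form a
    pair of nested subdomains.\<close>
  have "subdom A"
  proof (rule subdomI)
    show "1 \<in> A" unfolding A using f(3) by (intro image_eqI[of _ _ 1]) auto
    fix x y assume "x \<in> A" "y \<in> A"
    then obtain a b where "x = to_fract (f a)" "y = to_fract (f b)" by (auto simp: A)
    then have "x - y = to_fract (f (a - b))" "x * y = to_fract (f (a * b))" by (simp_all add: f f_diff)
    then show "x - y \<in> A" "x * y \<in> A" unfolding A by blast+
  qed
  moreover have "subdom B"
  proof (rule subdomI)
    show "1 \<in> B" unfolding B by (intro image_eqI[of _ _ 1]) auto
    fix x y assume "x \<in> B" "y \<in> B"
    then obtain a b where "x = to_fract a" "y = to_fract b" by (auto simp: B)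
    then have "x - y = to_fract (a - b)" "x * y = to_fract (a * b)" by simp_all
    then show "x - y \<in> B" "x * y \<in> B" unfolding B by blast+
  qed
  moreover have "A \<subseteq> B" by (auto simp: A B)
  ultimately have "real_domain A \<Longrightarrow> central_seminormalization_exists A B \<and>
      central_seminormalization A B = central_gluing A (integral_birational_closure_in A B)"
    and "\<not> real_domain A \<Longrightarrow> central_seminormalization_exists A B \<and>
      central_seminormalization A B = integral_closure_in A B \<and>
      integral_closure_in A B = central_gluing A (integral_closure_in A B)"
    using central_seminormalization_real[of A B] central_seminormalization_not_real[of A B] by auto
  \<comment> \<open>The displayed description of the gluing is its definition, hence the
    unfolding.\<close>
  then show ?thesis unfolding central_gluing_def by blast
qed

end
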